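(* Let $R,R'$ be projective surfaces with smooth conformal metrics $\rho,\sigma$, respectively, and let $f:R\to R'$ be a nonconstant holomorphic map. Then $$\Sigma^3_{\sigma,\rho}f=\rho^{-3}\left[V^3_{R,\rho,R'}f+f^*\Theta^3_{R',\sigma}-\Theta^3_{R,\rho}\right]+2\rho^{-2}\,f^*\Theta^2_{R',\sigma}\;Q^1_{\sigma,\rho}f,$$ where $f^*\Theta^n_{R',\sigma}$ is the pull-back $(\Theta^n_{R',\sigma}\circ f)(f')^n$ as an $n$-differential.
   Context: A projective surface is a surface with an equivalence class of atlases of complex charts whose transition maps are (restrictions of) Möbius transformations on each connected component; the charts of such atlases are called projective coordinates. A projective surface is regarded as a Riemann surface via its underlying complex structure. A conformal metric $\rho=\rho(z)|dz|$ is given in local coordinates by a smooth positive function, with $\rho(z)|dz|$ invariant under change of coordinates. Write $\partial=\partial/\partial z=\frac12(\partial_x-i\partial_y)$. For an $n$-differential $\varphi=\varphi(z)dz^n$ on a Riemann surface with conformal metric $\rho$, put $\Lambda_\rho(\varphi)=\left[\partial\varphi-2n(\partial\log\rho)\varphi\right]dz^{n+1}$, a well-defined $(n+1)$-differential. Projective Schwarzian of virtual order $3$: let $S_{R,R'}f$ be the meromorphic quadratic differential given in projective coordinates $z$ of $R$, $w$ of $R'$ by $S(w\circ f\circ z^{-1})dz^2$, where $Sg=\left(\frac{g''}{g'}\right)'-\frac12\left(\frac{g''}{g'}\right)^2$ (independent of the choice of projective coordinates). Then $V^3_{R,\rho,R'}f=\Lambda_\rho(S_{R,R'}f)$; in projective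 coordinates, $V^3_{R,\rho,R'}f=(Sf)'-4\frac{\partial\rho}{\rho}Sf$. Derivatives of the Schwarzian of the metric: $\Theta^2_{R,\rho}dz^2=\Theta_{R,\rho}dz^2$ is given in projective coordinates by $\Theta_{R,\rho}(z)=2\partial^2\log\rho(z)-2(\partial\log\rho(z))^2$, a well-defined smooth quadratic differential, and $\Theta^n_{R,\rho}dz^n=\Lambda_\rho^{n-2}(\Theta_{R,\rho}dz^2)$ for $n\ge2$; similarly $\Theta^n_{R',\sigma}$ on $R'$ using $\Lambda_\sigma$. Invariant Schwarzian: in local coordinates $z$ on $R$ and $w$ on $R'$ (identify $f$ with $w\circ f\circ z^{-1}$), set $\partial_\rho\varphi=\frac1{\rho}\frac{\partial\varphi}{\partial z}$, $\partial_\sigma\varphi=\frac1\sigma\frac{\partial\varphi}{\partial w}$, and define $$D^1f=\frac{\sigma\circ f}{\rho}f',\qquad D^{n+1}f=\left[\partial_\rho-n\,\partial_\rho(\log\rho)+(\partial_\sigma\log\sigma)\circ f\cdot D^1f\right]D^nf\quad(n\ge1),$$ $Q^n_{\sigma,\rho}f=Q^nf=D^{n+1}f/D^1f$, and $$\Sigma^3_{\sigma,\rho}f=Q^3f-4\,Q^1f\,Q^2f+3(Q^1f)^3$$ (defined where $f'\ne0$). $Q^nf$ (for $n\ge1$) and $\Sigma^3_{\sigma,\rho}f$ do not depend on the coordinate $w$; under a holomorphic change of coordinate $z=g(\hat z)$ they are composed with $g$ and multiplied by $(g'/|g'|)^n$ and $(g'/|g'|)^3$, respectively. The asserted identity is between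 the expressions evaluated in one and the same projective coordinate $z$ of $R$, at points where $f'\ne0$. *)

theory Defs
  imports "HOL-Analysis.Analysis"
begin

text \<open>Smoothness is meant for open sets; frechet derivatives are full derivatives at a point.\<close>

fun times_differentiable_on ::
  "nat \<Rightarrow> ('a::real_normed_vector \<Rightarrow> 'b::real_normed_vector) \<Rightarrow> 'a set \<Rightarrow> bool" where
  "times_differentiable_on 0 f S = continuous_on S f"
| "times_differentiable_on (Suc k) f S =
     ((\<forall>x\<in>S. f differentiable (at x)) \<and>
      (\<forall>v. times_differentiable_on k (\<lambda>x. frechet_derivative f (at x) v) S))"

definition smooth_on ::
  "('a::real_normed_vector \<Rightarrow> 'b::real_normed_vector) \<Rightarrow> 'a set \<Rightarrow> bool" where
  "smooth_on f S \<longleftrightarrow> (\<forall>k. times_differentiable_on k f S)"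

text \<open>The operator \<open>\<partial>/\<partial>z = (\<partial>/\<partial>x - i \<partial>/\<partial>y) / 2\<close> on complex-valued functions.\<close>

definition dz :: "(complex \<Rightarrow> complex) \<Rightarrow> complex \<Rightarrow> complex" where
  "dz \<phi> \<zeta> = (frechet_derivative \<phi> (at \<zeta>) 1 - \<i> * frechet_derivative \<phi> (at \<zeta>) \<i>) / 2"

definition dz_log :: "(complex \<Rightarrow> real) \<Rightarrow> complex \<Rightarrow> complex" where
  "dz_log r = dz (\<lambda>\<zeta>. complex_of_real (ln (r \<zeta>)))"


section \<open>Projective surfaces\<close>

text \<open>A chart is its domain together with the coordinate map; the values of the map
  outside the domain are irrelevant.\<close>

type_synonym 'a chart = "'a set \<times> ('a \<Rightarrow> complex)"

definition chart_dom :: "'a chart \<Rightarrow> 'a set" where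
  "chart_dom z = fst z"

definition chart_img :: "'a chart \<Rightarrow> complex set" where
  "chart_img z = snd z ` fst z"

definition chart_inv :: "'a chart \<Rightarrow> complex \<Rightarrow> 'a" where
  "chart_inv z = inv_into (fst z) (snd z)"

definition complex_chart :: "'a topology \<Rightarrow> 'a chart \<Rightarrow> bool" where
  "complex_chart X z \<longleftrightarrow>
     openin X (chart_dom z) \<and> open (chart_img z) \<and>
     homeomorphic_map (subtopology X (chart_dom z)) (top_of_set (chart_img z)) (snd z)"

definition transition :: "'a chart \<Rightarrow> 'a chart \<Rightarrow> complex \<Rightarrow> complex" where
  "transition z w = snd w \<circ> chart_inv z"

definition transition_dom :: "'a chart \<Rightarrow> 'a chart \<Rightarrow> complex set" where
  "transition_dom z w = snd z ` (chart_dom z \<inter> chart_dom w)"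

definition locally_moebius_on :: "(complex \<Rightarrow> complex) \<Rightarrow> complex set \<Rightarrow> bool" where
  "locally_moebius_on g S \<longleftrightarrow>
     (\<forall>C \<in> components S. \<exists>a b c d. a * d - b * c \<noteq> 0 \<and>
        (\<forall>\<zeta>\<in>C. c * \<zeta> + d \<noteq> 0 \<and> g \<zeta> = moebius a b c d \<zeta>))"

definition projective_atlas :: "'a topology \<Rightarrow> 'a chart set \<Rightarrow> bool" where
  "projective_atlas X A \<longleftrightarrow>
     (\<forall>z\<in>A. complex_chart X z) \<and> topspace X = (\<Union>z\<in>A. chart_dom z) \<and>
     (\<forall>z\<in>A. \<forall>w\<in>A. locally_moebius_on (transition z w) (transition_dom z w))"

definition complex_atlas :: "'a topology \<Rightarrow> 'a chart set \<Rightarrow> bool" where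
  "complex_atlas X A \<longleftrightarrow>
     (\<forall>z\<in>A. complex_chart X z) \<and> topspace X = (\<Union>z\<in>A. chart_dom z) \<and>
     (\<forall>z\<in>A. \<forall>w\<in>A. transition z w holomorphic_on transition_dom z w)"

text \<open>The equivalence class of atlases is given by a representative \<open>A\<close>; the charts of the
  atlases equivalent to \<open>A\<close> are those which can be added to \<open>A\<close>. As usual for Riemann surfaces,
  the surface is connected.\<close>

definition projective_surface :: "'a topology \<Rightarrow> 'a chart set \<Rightarrow> bool" where
  "projective_surface X A \<longleftrightarrow> Hausdorff_space X \<and> connected_space X \<and> projective_atlas X A"

definition projective_coordinate :: "'a topology \<Rightarrow> 'a chart set \<Rightarrow> 'a chart \<Rightarrow> bool" where
  "projective_coordinate X A z \<longleftrightarrow> projective_atlas X (insert z A)"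

text \<open>Local coordinates of the underlying Riemann surface.\<close>

definition local_coordinate :: "'a topology \<Rightarrow> 'a chart set \<Rightarrow> 'a chart \<Rightarrow> bool" where
  "local_coordinate X A z \<longleftrightarrow> complex_atlas X (insert z A)"

definition coord_rep :: "'a chart \<Rightarrow> 'b chart \<Rightarrow> ('a \<Rightarrow> 'b) \<Rightarrow> complex \<Rightarrow> complex" where
  "coord_rep z w f = snd w \<circ> f \<circ> chart_inv z"

definition holomorphic_surface_map ::
  "'a topology \<Rightarrow> 'a chart set \<Rightarrow> 'b topology \<Rightarrow> 'b chart set \<Rightarrow> ('a \<Rightarrow> 'b) \<Rightarrow> bool" where
  "holomorphic_surface_map X A Y B f \<longleftrightarrow>
     continuous_map X Y f \<and>
     (\<forall>z w. local_coordinate X A z \<longrightarrow> local_coordinate Y B w \<longrightarrow>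
        coord_rep z w f holomorphic_on (snd z ` {p \<in> chart_dom z. f p \<in> chart_dom w}))"


section \<open>Conformal metrics and differentials\<close>

text \<open>A metric or differential is given by its coefficient function in each coordinate.\<close>

definition conformal_metric ::
  "'a topology \<Rightarrow> 'a chart set \<Rightarrow> ('a chart \<Rightarrow> complex \<Rightarrow> real) \<Rightarrow> bool" where
  "conformal_metric X A \<rho> \<longleftrightarrow>
     (\<forall>z. local_coordinate X A z \<longrightarrow>
        smooth_on (\<rho> z) (chart_img z) \<and> (\<forall>\<zeta>\<in>chart_img z. \<rho> z \<zeta> > 0)) \<and>
     (\<forall>z w. local_coordinate X A z \<longrightarrow> local_coordinate X A w \<longrightarrow>
        (\<forall>\<zeta>\<in>transition_dom z w.
           \<rho> z \<zeta> = \<rho> w (transition z w \<zeta>) * cmod (deriv (transition z w) \<zeta>)))"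

type_synonym 'a differential = "'a chart \<Rightarrow> complex \<Rightarrow> complex"

text \<open>\<open>Lam \<rho> n\<close> is \<open>\<Lambda>\<^sub>\<rho>\<close> on \<open>n\<close>-differentials; \<open>Lam_iter \<rho> n k\<close> is \<open>\<Lambda>\<^sub>\<rho>\<^sup>k\<close>, from \<open>n\<close>- to
  \<open>(n+k)\<close>-differentials.\<close>

definition Lam ::
  "('a chart \<Rightarrow> complex \<Rightarrow> real) \<Rightarrow> nat \<Rightarrow> 'a differential \<Rightarrow> 'a differential" where
  "Lam \<rho> n \<phi> = (\<lambda>z \<zeta>. dz (\<phi> z) \<zeta> - 2 * of_nat n * dz_log (\<rho> z) \<zeta> * \<phi> z \<zeta>)"

primrec Lam_iter ::
  "('a chart \<Rightarrow> complex \<Rightarrow> real) \<Rightarrow> nat \<Rightarrow> nat \<Rightarrow> 'a differential \<Rightarrow> 'a differential" where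
  "Lam_iter \<rho> n 0 \<phi> = \<phi>"
| "Lam_iter \<rho> n (Suc k) \<phi> = Lam \<rho> (n + k) (Lam_iter \<rho> n k \<phi>)"

text \<open>The coefficient of \<open>\<Theta>\<^sup>n\<close> in projective coordinates, for \<open>n \<ge> 2\<close>.\<close>

definition Theta :: "('a chart \<Rightarrow> complex \<Rightarrow> real) \<Rightarrow> nat \<Rightarrow> 'a differential" where
  "Theta \<rho> n = Lam_iter \<rho> 2 (n - 2)
     (\<lambda>z \<zeta>. 2 * dz (dz_log (\<rho> z)) \<zeta> - 2 * (dz_log (\<rho> z) \<zeta>)\<^sup>2)"

text \<open>In the following, \<open>Y\<close>, \<open>B\<close> is the target surface, and the definite descriptions say that
  the value is the common one for all coordinates \<open>w\<close> around the image point.\<close>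

definition pullback ::
  "'b topology \<Rightarrow> 'b chart set \<Rightarrow> ('a \<Rightarrow> 'b) \<Rightarrow> nat \<Rightarrow> 'b differential \<Rightarrow> 'a differential" where
  "pullback Y B f n \<phi> z \<zeta> =
     (THE s. \<forall>w. projective_coordinate Y B w \<longrightarrow> f (chart_inv z \<zeta>) \<in> chart_dom w \<longrightarrow>
        s = \<phi> w (coord_rep z w f \<zeta>) * deriv (coord_rep z w f) \<zeta> ^ n)"

definition schwarzian :: "(complex \<Rightarrow> complex) \<Rightarrow> complex \<Rightarrow> complex" where
  "schwarzian g \<zeta> =
     deriv (\<lambda>t. deriv (deriv g) t / deriv g t) \<zeta> - (deriv (deriv g) \<zeta> / deriv g \<zeta>)\<^sup>2 / 2"

definition proj_schwarzian ::
  "'b topology \<Rightarrow> 'b chart set \<Rightarrow> ('a \<Rightarrow> 'b) \<Rightarrow> 'a differential" where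
  "proj_schwarzian Y B f z \<zeta> =
     (THE s. \<forall>w. projective_coordinate Y B w \<longrightarrow> f (chart_inv z \<zeta>) \<in> chart_dom w \<longrightarrow>
        s = schwarzian (coord_rep z w f) \<zeta>)"

definition V3 ::
  "('a chart \<Rightarrow> complex \<Rightarrow> real) \<Rightarrow> 'b topology \<Rightarrow> 'b chart set \<Rightarrow> ('a \<Rightarrow> 'b) \<Rightarrow> 'a differential"
  where "V3 \<rho> Y B f = Lam \<rho> 2 (proj_schwarzian Y B f)"


section \<open>Invariant Schwarzian\<close>

text \<open>\<open>D\<^sup>n g\<close> for a coordinate representation \<open>g\<close> and metric densities \<open>r\<close>, \<open>s\<close> in the coordinates
  of source and target; \<open>n \<ge> 1\<close>, the value for \<open>n = 0\<close> being a dummy.\<close>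

definition dz_metric ::
  "(complex \<Rightarrow> real) \<Rightarrow> (complex \<Rightarrow> complex) \<Rightarrow> complex \<Rightarrow> complex" where
  "dz_metric r \<phi> \<zeta> = dz \<phi> \<zeta> / complex_of_real (r \<zeta>)"

fun inv_D ::
  "(complex \<Rightarrow> real) \<Rightarrow> (complex \<Rightarrow> real) \<Rightarrow> (complex \<Rightarrow> complex) \<Rightarrow> nat \<Rightarrow> complex \<Rightarrow> complex" where
  "inv_D s r g 0 = (\<lambda>\<zeta>. 0)"
| "inv_D s r g (Suc 0) = (\<lambda>\<zeta>. complex_of_real (s (g \<zeta>)) / complex_of_real (r \<zeta>) * deriv g \<zeta>)"
| "inv_D s r g (Suc (Suc m)) = (\<lambda>\<zeta>.
     dz_metric r (inv_D s r g (Suc m)) \<zeta>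
     + (- of_nat (Suc m) * dz_metric r (\<lambda>t. complex_of_real (ln (r t))) \<zeta>
        + dz_metric s (\<lambda>t. complex_of_real (ln (s t))) (g \<zeta>) * inv_D s r g (Suc 0) \<zeta>)
       * inv_D s r g (Suc m) \<zeta>)"

definition inv_Q ::
  "'b topology \<Rightarrow> 'b chart set \<Rightarrow> ('b chart \<Rightarrow> complex \<Rightarrow> real) \<Rightarrow> ('a chart \<Rightarrow> complex \<Rightarrow> real) \<Rightarrow>
   nat \<Rightarrow> ('a \<Rightarrow> 'b) \<Rightarrow> 'a chart \<Rightarrow> complex \<Rightarrow> complex" where
  "inv_Q Y B \<sigma> \<rho> n f z \<zeta> =
     (THE q. \<forall>w. local_coordinate Y B w \<longrightarrow> f (chart_inv z \<zeta>) \<in> chart_dom w \<longrightarrow>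
        q = inv_D (\<sigma> w) (\<rho> z) (coord_rep z w f) (n + 1) \<zeta>
            / inv_D (\<sigma> w) (\<rho> z) (coord_rep z w f) 1 \<zeta>)"

definition Sigma3 ::
  "'b topology \<Rightarrow> 'b chart set \<Rightarrow> ('b chart \<Rightarrow> complex \<Rightarrow> real) \<Rightarrow> ('a chart \<Rightarrow> complex \<Rightarrow> real) \<Rightarrow>
   ('a \<Rightarrow> 'b) \<Rightarrow> 'a chart \<Rightarrow> complex \<Rightarrow> complex" where
  "Sigma3 Y B \<sigma> \<rho> f z \<zeta> =
     inv_Q Y B \<sigma> \<rho> 3 f z \<zeta> - 4 * inv_Q Y B \<sigma> \<rho> 1 f z \<zeta> * inv_Q Y B \<sigma> \<rho> 2 f z \<zeta>
     + 3 * (inv_Q Y B \<sigma> \<rho> 1 f z \<zeta>) ^ 3"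

end

theory Submission
  imports Defs "HOL-Complex_Analysis.Conformal_Mappings"
begin

text \<open>In coordinates write \<open>b = \<partial> log \<rho>\<close>, \<open>a = \<partial> log \<sigma>\<close> and
  \<open>P = f''/f' + 2 (a \<circ> f) f' - 2 b\<close>. Then \<open>Q\<^sup>1 = P/\<rho>\<close> and
  \<open>Q\<^sup>n\<^sup>+\<^sup>1 = \<partial>\<^sub>\<rho> Q\<^sup>n + (Q\<^sup>1 - n \<partial>\<^sub>\<rho> log \<rho>) Q\<^sup>n\<close>, so that \<open>\<rho>\<^sup>3 \<Sigma>\<^sup>3 = \<Lambda>\<^sub>\<rho> E\<close> with
  \<open>E = \<partial>P - P\<^sup>2/2 - 2 b P = Sf + f\<^sup>*\<Theta>\<^sub>\<sigma> - \<Theta>\<^sub>\<rho>\<close>. The theorem follows from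
  \<open>\<Lambda>\<^sub>\<rho> (f\<^sup>*\<Theta>\<^sub>\<sigma>) = f\<^sup>*(\<Lambda>\<^sub>\<sigma> \<Theta>\<^sub>\<sigma>) + 2 P f\<^sup>*\<Theta>\<^sub>\<sigma>\<close>. A change of coordinates is an isometry, for which
  \<open>P = 0\<close>; together with the chain rules for \<open>P\<close> and \<open>S\<close> this shows that all terms are independent of
  the coordinate on the target.\<close>

section \<open>The operator \<open>\<partial>/\<partial>z\<close>\<close>

text \<open>Differentiability is included because \<^const>\<open>dz\<close> is a junk value without it.\<close>

definition has_dz :: "(complex \<Rightarrow> complex) \<Rightarrow> complex \<Rightarrow> complex \<Rightarrow> bool" where
  "has_dz f D x \<longleftrightarrow> f differentiable (at x) \<and> dz f x = D"

lemma has_dzI: "(f has_derivative F) (at x) \<Longrightarrow> D = (F 1 - \<i> * F \<i>) / 2 \<Longrightarrow> has_dz f D x"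
  using frechet_derivative_at[of f F x] by (auto simp: has_dz_def dz_def differentiable_def)

lemma has_dzE:
  assumes "has_dz f D x"
  obtains F where "(f has_derivative F) (at x)" "D = (F 1 - \<i> * F \<i>) / 2"
  using assms frechet_derivative_works[of f "at x"] unfolding has_dz_def dz_def by blast

lemma has_dz_imp_dz: "has_dz f D x \<Longrightarrow> dz f x = D"
  by (simp add: has_dz_def)

lemma differentiable_has_dz: "f differentiable (at x) \<Longrightarrow> has_dz f (dz f x) x"
  by (simp add: has_dz_def)

lemma has_dz_const: "has_dz (\<lambda>t. c) 0 x"
  by (rule has_dzI[OF has_derivative_const]) auto

lemma has_dz_add: "has_dz f D x \<Longrightarrow> has_dz g E x \<Longrightarrow> has_dz (\<lambda>t. f t + g t) (D + E) x"
  by (elim has_dzE, rule has_dzI[OF has_derivative_add]) (auto simp: field_simps)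

lemma has_dz_diff: "has_dz f D x \<Longrightarrow> has_dz g E x \<Longrightarrow> has_dz (\<lambda>t. f t - g t) (D - E) x"
  by (elim has_dzE, rule has_dzI[OF has_derivative_diff]) (auto simp: field_simps)

lemma has_dz_mult:
  assumes "has_dz f D x" "has_dz g E x"
  shows "has_dz (\<lambda>t. f t * g t) (D * g x + f x * E) x"
proof -
  obtain F G where F: "(f has_derivative F) (at x)" "D = (F 1 - \<i> * F \<i>) / 2"
    and G: "(g has_derivative G) (at x)" "E = (G 1 - \<i> * G \<i>) / 2"
    using assms by (elim has_dzE)
  show ?thesis
    by (rule has_dzI[OF has_derivative_mult[OF F(1) G(1)]]) (simp add: F(2) G(2) field_simps)
qed

lemma has_dz_holo: "(f has_field_derivative D) (at x) \<Longrightarrow> has_dz f D x"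
  by (rule has_dzI[OF has_field_derivative_imp_has_derivative]) (auto simp: field_simps)

text \<open>The derivative of \<open>h\<close> is complex linear and so commutes with the
  combination of directional derivatives that forms \<open>dz\<close>; \<open>f\<close> itself may
  be merely real differentiable.\<close>

lemma has_dz_holo_comp:
  assumes "(h has_field_derivative H) (at (f x))" "has_dz f D x"
  shows "has_dz (\<lambda>t. h (f t)) (H * D) x"
proof -
  obtain F where F: "(f has_derivative F) (at x)" "D = (F 1 - \<i> * F \<i>) / 2"
    using assms(2) by (elim has_dzE)
  show ?thesis
    using has_derivative_compose[OF F(1) has_field_derivative_imp_has_derivative[OF assms(1)]]
    by (rule has_dzI) (auto simp: F(2) field_simps)
qed

text \<open>For real differentiable \<open>f\<close> the chain rule has a second term, the
  antiholomorphic derivative of \<open>f\<close> times \<open>dz\<close> of the conjugate of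
  \<open>g\<close>. It vanishes because \<open>g\<close> is holomorphic.\<close>

lemma has_dz_comp_holo:
  assumes "has_dz f D (g x)" "(g has_field_derivative G) (at x)"
  shows "has_dz (\<lambda>t. f (g t)) (D * G) x"
proof -
  obtain F where F: "(f has_derivative F) (at (g x))" "D = (F 1 - \<i> * F \<i>) / 2"
    using assms(1) by (elim has_dzE)
  interpret linear F using F(1) has_derivative_linear by blast
  \<comment> \<open>\<open>F\<close> is only real linear, so it has to be expanded along
    \<open>1\<close> and \<open>\<i>\<close> before it is evaluated at \<open>G\<close> and
    \<open>G * \<i>\<close>.\<close>
  have lin: "F v = of_real (Re v) * F 1 + of_real (Im v) * F \<i>" for v
  proof -
    have "F v = F (Re v *\<^sub>R 1 + Im v *\<^sub>R \<i>)"
      by (simp add: scaleR_conv_of_real mult.commute flip: complex_eq)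
    also have "\<dots> = Re v *\<^sub>R F 1 + Im v *\<^sub>R F \<i>" by (simp only: add scale)
    finally show ?thesis by (simp add: scaleR_conv_of_real)
  qed
  have *: "(of_real (Re G) + of_real (Im G) * \<i>) = G"
    using complex_eq[of G] by (simp add: mult.commute)
  have "D * G = D * (of_real (Re G) + of_real (Im G) * \<i>)" by (simp only: *)
  also have "\<dots> = (F (G * 1) - \<i> * F (G * \<i>)) / 2"
    unfolding lin[of "G * 1"] lin[of "G * \<i>"] F(2) by (simp add: algebra_simps)
  finally show ?thesis
    using has_derivative_compose[OF has_field_derivative_imp_has_derivative[OF assms(2)] F(1)]
    by (intro has_dzI)
qed

lemma has_dz_inverse:
  assumes "has_dz f D x" "f x \<noteq> 0"
  shows "has_dz (\<lambda>t. inverse (f t)) (- D / (f x)\<^sup>2) x"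
proof -
  have "(inverse has_field_derivative - (inverse (f x) * inverse (f x))) (at (f x))"
    using DERIV_inverse[OF assms(2), of UNIV] by (simp add: power2_eq_square numeral_2_eq_2)
  from has_dz_holo_comp[of inverse, OF this assms(1)] show ?thesis
    by (simp add: divide_inverse power2_eq_square mult.commute)
qed

lemma has_dz_divide:
  "has_dz f D x \<Longrightarrow> has_dz g E x \<Longrightarrow> g x \<noteq> 0 \<Longrightarrow>
    has_dz (\<lambda>t. f t / g t) ((D * g x - f x * E) / (g x)\<^sup>2) x"
  using has_dz_mult[OF _ has_dz_inverse, of f D x g E]
  by (simp add: divide_inverse algebra_simps power2_eq_square)

lemma has_dz_power2: "has_dz f D x \<Longrightarrow> has_dz (\<lambda>t. (f t)\<^sup>2) (2 * f x * D) x"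
  using has_dz_mult[of f D x f D] by (simp add: power2_eq_square algebra_simps)

lemma has_derivative_cong_on:
  assumes "open U" "x \<in> U" "\<And>t. t \<in> U \<Longrightarrow> f t = h t"
  shows "(f has_derivative F) (at x) \<longleftrightarrow> (h has_derivative F) (at x)"
  using has_derivative_transform_within_open[of f F x UNIV U h]
    has_derivative_transform_within_open[of h F x UNIV U f] assms by auto

lemma frechet_derivative_cong_on:
  assumes "open U" "x \<in> U" "\<And>t. t \<in> U \<Longrightarrow> f t = h t"
  shows "frechet_derivative f (at x) = frechet_derivative h (at x)"
  using has_derivative_cong_on[of U x f h, OF assms] by (simp add: frechet_derivative_def)

lemma dz_cong_on:
  assumes "open U" "x \<in> U" "\<And>t. t \<in> U \<Longrightarrow> f t = h t"
  shows "dz f x = dz h x"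
  using frechet_derivative_cong_on[of U x f h, OF assms] by (simp add: dz_def)

lemma has_dz_cong_on:
  assumes "has_dz f D x" "open U" "x \<in> U" "\<And>t. t \<in> U \<Longrightarrow> f t = h t"
  shows "has_dz h D x"
  using assms(1) has_derivative_cong_on[of U x f h, OF assms(2-4)] dz_cong_on[of U x f h, OF assms(2-4)]
  by (simp add: has_dz_def differentiable_def)

text \<open>As \<open>|h|^2\<close> is \<open>h\<close> times its conjugate and \<open>dz\<close>
  kills the conjugate, the logarithmic derivative of \<open>|h|\<close> is half that of
  \<open>h\<close>. This is needed to differentiate the transformation law of a metric, which
  contains the modulus of a derivative.\<close>

lemma has_dz_of_real_cmod:
  assumes "(h has_field_derivative H) (at x)" "h x \<noteq> 0"
  shows "has_dz (\<lambda>t. of_real (cmod (h t))) (of_real (cmod (h x)) * H / (2 * h x)) x"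
proof -
  have "((\<lambda>t. cmod (h t)) has_derivative (\<lambda>v. (H * v) \<bullet> sgn (h x))) (at x)"
    using has_derivative_compose[OF has_field_derivative_imp_has_derivative[OF assms(1)] has_derivative_norm[OF assms(2)]]
    by (simp add: mult.commute)
  then have *: "((\<lambda>t. complex_of_real (cmod (h t))) has_derivative (\<lambda>v. of_real ((H * v) \<bullet> sgn (h x)))) (at x)"
    by (rule has_derivative_of_real)
  have h: "of_real (cmod (h x)) * of_real (cmod (h x)) = h x * cnj (h x)"
    using complex_norm_square[of "h x"] by (simp add: power2_eq_square)
  have c: "of_real (H \<bullet> sgn (h x)) - \<i> * of_real ((H * \<i>) \<bullet> sgn (h x)) = H * cnj (sgn (h x))"
    by (simp add: complex_eq_iff inner_complex_def algebra_simps)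
  have "of_real (cmod (h x)) * H / h x = H * cnj (sgn (h x))"
    using assms(2) h by (simp add: sgn_div_norm scaleR_conv_of_real field_simps)
  then show ?thesis
    by (intro has_dzI[OF *]) (simp add: c[symmetric] field_simps)
qed

section \<open>Closure properties of smooth functions on open sets\<close>

lemma times_differentiable_on_cong:
  "times_differentiable_on k f S \<Longrightarrow> open S \<Longrightarrow> (\<And>x. x \<in> S \<Longrightarrow> f x = h x) \<Longrightarrow>
    times_differentiable_on k h S"
proof (induction k arbitrary: f h)
  case 0
  then show ?case using continuous_on_cong[of S S f h] by auto
next
  case (Suc k)
  have "h differentiable (at x)" if "x \<in> S" for x
  proof -
    obtain D where "(f has_derivative D) (at x)"
      using Suc.prems(1) \<open>x \<in> S\<close> by (auto simp: differentiable_def)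
    then show ?thesis
      using has_derivative_cong_on[of S x f h, OF Suc.prems(2) \<open>x \<in> S\<close> Suc.prems(3)]
      by (auto simp: differentiable_def)
  qed
  moreover have "times_differentiable_on k (\<lambda>x. frechet_derivative h (at x) v) S" for v
    by (rule Suc.IH[of "\<lambda>x. frechet_derivative f (at x) v"])
      (use Suc.prems frechet_derivative_cong_on[of S _ f h, OF Suc.prems(2) _ Suc.prems(3)] in simp_all)
  ultimately show ?case by simp
qed

lemma times_differentiable_on_bounded_linear:
  assumes "bounded_linear L" "open S"
  shows "times_differentiable_on k f S \<Longrightarrow> times_differentiable_on k (\<lambda>x. L (f x)) S"
proof (induction k arbitrary: f)
  case 0
  then show ?case by (simp add: bounded_linear.continuous_on[OF assms(1)])
next
  case (Suc k)
  have D: "((\<lambda>x. L (f x)) has_derivative (\<lambda>v. L (frechet_derivative f (at x) v))) (at x)" if "x \<in> S" for x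
    using Suc.prems that by (auto intro: bounded_linear.has_derivative[OF assms(1)] simp: frechet_derivative_works[symmetric])
  have "times_differentiable_on k (\<lambda>x. frechet_derivative (\<lambda>x. L (f x)) (at x) v) S" for v
    by (rule times_differentiable_on_cong[OF Suc.IH[of "\<lambda>x. frechet_derivative f (at x) v"] assms(2)])
      (use Suc.prems in \<open>simp_all add: frechet_derivative_at[OF D, symmetric]\<close>)
  then show ?case using D by (auto simp: differentiable_def)
qed

lemma times_differentiable_on_add:
  assumes "open S"
  shows "times_differentiable_on k f S \<Longrightarrow> times_differentiable_on k g S \<Longrightarrow>
    times_differentiable_on k (\<lambda>x. f x + g x) S"
proof (induction k arbitrary: f g)
  case 0
  then show ?case by (simp add: continuous_on_add)
next
  case (Suc k)
  have D: "((\<lambda>x. f x + g x) has_derivative (\<lambda>v. frechet_derivative f (at x) v + frechet_derivative g (at x) v)) (at x)" if "x \<in> S" for x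
    using Suc.prems that by (auto intro: has_derivative_add simp: frechet_derivative_works[symmetric])
  have "times_differentiable_on k (\<lambda>x. frechet_derivative (\<lambda>x. f x + g x) (at x) v) S" for v
    by (rule times_differentiable_on_cong[OF Suc.IH[of "\<lambda>x. frechet_derivative f (at x) v"
          "\<lambda>x. frechet_derivative g (at x) v"] assms])
      (use Suc.prems in \<open>simp_all add: frechet_derivative_at[OF D, symmetric]\<close>)
  then show ?case using D by (auto simp: differentiable_def)
qed

lemma smooth_on_subset: "smooth_on f S \<Longrightarrow> T \<subseteq> S \<Longrightarrow> smooth_on f T"
proof -
  have "times_differentiable_on k f S \<Longrightarrow> T \<subseteq> S \<Longrightarrow> times_differentiable_on k f T" for k
    by (induction k arbitrary: f) (auto intro: continuous_on_subset)
  then show "smooth_on f S \<Longrightarrow> T \<subseteq> S \<Longrightarrow> smooth_on f T" by (auto simp: smooth_on_def)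
qed

lemma smooth_on_imp_differentiable: "smooth_on f S \<Longrightarrow> x \<in> S \<Longrightarrow> f differentiable (at x)"
proof -
  assume "smooth_on f S" "x \<in> S"
  then have "times_differentiable_on (Suc 0) f S" "x \<in> S" unfolding smooth_on_def by blast+
  then show ?thesis by simp
qed

text \<open>\<open>dz f\<close> is a combination with constant coefficients of the directional
  derivatives along \<open>1\<close> and \<open>\<i>\<close>; these are \<open>k\<close> times
  differentiable because \<open>f\<close> is \<open>k + 1\<close> times differentiable.\<close>

lemma smooth_on_dz:
  assumes "smooth_on f S" "open S"
  shows "smooth_on (dz f) S"
  unfolding smooth_on_def
proof
  fix k
  have *: "times_differentiable_on k (\<lambda>x. frechet_derivative f (at x) v) S" for v
  proof -
    have "times_differentiable_on (Suc k) f S" using assms(1) unfolding smooth_on_def by blast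
    then show ?thesis by simp
  qed
  have "times_differentiable_on k (\<lambda>x. frechet_derivative f (at x) 1 * (1/2) + frechet_derivative f (at x) \<i> * (- \<i> / 2)) S"
    by (intro times_differentiable_on_add times_differentiable_on_bounded_linear[OF bounded_linear_mult_left] * assms(2))
  then show "times_differentiable_on k (dz f) S"
    by (rule times_differentiable_on_cong[OF _ assms(2)]) (simp add: dz_def field_simps)
qed

lemma smooth_on_of_real: "smooth_on r S \<Longrightarrow> open S \<Longrightarrow> smooth_on (\<lambda>x. complex_of_real (r x)) S"
  by (simp add: smooth_on_def times_differentiable_on_bounded_linear[OF bounded_linear_of_real])

section \<open>Conformal immersions of plane domains\<close>

definition smooth_density :: "(complex \<Rightarrow> real) \<Rightarrow> complex set \<Rightarrow> bool" where
  "smooth_density r U \<longleftrightarrow> open U \<and> smooth_on r U \<and> (\<forall>x\<in>U. r x > 0)"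

lemma smooth_density_subset:
  "smooth_density r U \<Longrightarrow> open V \<Longrightarrow> V \<subseteq> U \<Longrightarrow> smooth_density r V"
  by (auto simp: smooth_density_def intro: smooth_on_subset)

lemma has_dz_of_real_ln:
  assumes "r differentiable (at x)" "r x > 0"
  shows "has_dz (\<lambda>t. of_real (ln (r t))) (dz (\<lambda>t. of_real (r t)) x / of_real (r x)) x"
proof -
  obtain F where F: "(r has_derivative F) (at x)" using assms by (auto simp: differentiable_def)
  have 1: "((\<lambda>t. ln (r t)) has_derivative (\<lambda>v. F v / r x)) (at x)"
    using assms(2) by (auto intro!: derivative_eq_intros F simp: divide_inverse mult.commute)
  have 2: "dz (\<lambda>t. of_real (r t)) x = (of_real (F 1) - \<i> * of_real (F \<i>)) / 2"
    by (rule has_dz_imp_dz[OF has_dzI[OF has_derivative_of_real[OF F]]]) simp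
  show ?thesis
    by (rule has_dzI[OF has_derivative_of_real[OF 1]]) (use assms(2) in \<open>simp add: 2 field_simps\<close>)
qed

context
  fixes r U
  assumes r: "smooth_density r U"
begin

lemma density_open: "open U" and density_pos: "x \<in> U \<Longrightarrow> r x > 0"
  using r by (auto simp: smooth_density_def)

lemma density_smooth: "smooth_on (\<lambda>t. complex_of_real (r t)) U"
  using r smooth_on_of_real by (auto simp: smooth_density_def)

text \<open>A quotient of functions already known to be smooth; with it the higher derivatives of
  \<open>dz_log r\<close> come from the quotient rule, without a smoothness theory for
  \<open>ln\<close>.\<close>

lemma dz_log_eq: "x \<in> U \<Longrightarrow> dz_log r x = dz (\<lambda>t. of_real (r t)) x / of_real (r x)"
  using r has_dz_imp_dz[OF has_dz_of_real_ln[of r x]] smooth_on_imp_differentiable[of r U x]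
  by (simp add: dz_log_def smooth_density_def)

lemma has_dz_density: "x \<in> U \<Longrightarrow> has_dz (\<lambda>t. of_real (r t)) (of_real (r x) * dz_log r x) x"
  using dz_log_eq[of x] density_pos[of x]
    differentiable_has_dz[OF smooth_on_imp_differentiable[OF density_smooth, of x]] by simp

lemma has_dz_dz_log:
  assumes "x \<in> U"
  shows "has_dz (dz_log r) (dz (dz_log r) x) x"
    and "has_dz (dz (dz_log r)) (dz (dz (dz_log r)) x) x"
proof -
  let ?R = "\<lambda>t. complex_of_real (r t)"
  note s0 = density_smooth
  note s1 = smooth_on_dz[OF s0 density_open]
  note s2 = smooth_on_dz[OF s1 density_open]
  have R0: "?R x \<noteq> 0" if "x \<in> U" for x using density_pos[OF that] by simp
  have d: "has_dz ?R (dz ?R x) x" "has_dz (dz ?R) (dz (dz ?R) x) x"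
      "has_dz (dz (dz ?R)) (dz (dz (dz ?R)) x) x" if "x \<in> U" for x
    using that s0 s1 s2 by (auto intro!: differentiable_has_dz smooth_on_imp_differentiable)
  have 1: "has_dz (dz_log r) ((dz (dz ?R) x * ?R x - dz ?R x * dz ?R x) / (?R x)\<^sup>2) x" if "x \<in> U" for x
    by (rule has_dz_cong_on[OF has_dz_divide[OF d(2,1) R0] density_open])
      (use that dz_log_eq in auto)
  show "has_dz (dz_log r) (dz (dz_log r) x) x"
    using 1[OF assms] by (simp add: has_dz_def)
  have "(\<lambda>t. (dz (dz ?R) t * ?R t - dz ?R t * dz ?R t) / (?R t)\<^sup>2) differentiable (at x)"
  proof -
    have "\<exists>D. has_dz (\<lambda>t. (dz (dz ?R) t * ?R t - dz ?R t * dz ?R t) / (?R t)\<^sup>2) D x"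
      using R0[OF assms]
      by (intro exI) (rule has_dz_divide has_dz_diff has_dz_mult has_dz_power2 d assms | simp)+
    then show ?thesis by (auto simp: has_dz_def)
  qed
  \<comment> \<open>Formula \<open>1\<close> holds on all of \<open>U\<close>, so differentiability
    of its right-hand side passes to \<open>dz (dz_log r)\<close>.\<close>
  from has_dz_cong_on[OF differentiable_has_dz[OF this] density_open assms has_dz_imp_dz[OF 1, symmetric]]
  have "\<exists>D. has_dz (dz (dz_log r)) D x" by blast
  then show "has_dz (dz (dz_log r)) (dz (dz (dz_log r)) x) x" by (auto simp: has_dz_def)
qed

end

text \<open>The coefficient of \<open>Theta\<close> of order 2 in a single coordinate. Together with
  \<open>Lam_coeff\<close> it lets the computations in the plane work with bare densities instead of
  charts.\<close>

definition log_density_schwarzian :: "(complex \<Rightarrow> real) \<Rightarrow> complex \<Rightarrow> complex" where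
  "log_density_schwarzian r x = 2 * dz (dz_log r) x - 2 * (dz_log r x)\<^sup>2"

definition Lam_coeff :: "(complex \<Rightarrow> real) \<Rightarrow> nat \<Rightarrow> (complex \<Rightarrow> complex) \<Rightarrow> complex \<Rightarrow> complex" where
  "Lam_coeff r n \<phi> x = dz \<phi> x - 2 * of_nat n * dz_log r x * \<phi> x"

lemma has_dz_log_density_schwarzian:
  assumes "smooth_density r U" "x \<in> U"
  shows "has_dz (log_density_schwarzian r) (dz (log_density_schwarzian r) x) x"
proof -
  have "\<exists>D. has_dz (\<lambda>x. 2 * dz (dz_log r) x - 2 * (dz_log r x)\<^sup>2) D x"
    by (intro exI) (rule has_dz_diff has_dz_mult has_dz_const has_dz_power2 has_dz_dz_log[OF assms])+
  then show ?thesis by (auto simp: has_dz_def log_density_schwarzian_def[abs_def])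
qed

text \<open>This is \<open>P\<close> of the overview: twice \<open>dz\<close> of the logarithm of
  the ratio between the pulled-back density, \<open>s\<close> after \<open>g\<close> times
  \<open>|g'|\<close>, and the density \<open>r\<close>. Hence it vanishes for isometries and obeys
  a cocycle rule under composition.\<close>

definition rho_Q1 ::
  "(complex \<Rightarrow> real) \<Rightarrow> (complex \<Rightarrow> real) \<Rightarrow> (complex \<Rightarrow> complex) \<Rightarrow> complex \<Rightarrow> complex" where
  "rho_Q1 s r g x =
     deriv (deriv g) x / deriv g x + 2 * dz_log s (g x) * deriv g x - 2 * dz_log r x"

locale conformal_immersion =
  fixes U V :: "complex set" and r s :: "complex \<Rightarrow> real" and g :: "complex \<Rightarrow> complex"
  assumes r: "smooth_density r U" and s: "smooth_density s V"
    and g: "g holomorphic_on U" and gV: "\<And>x. x \<in> U \<Longrightarrow> g x \<in> V"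
    and g0: "\<And>x. x \<in> U \<Longrightarrow> deriv g x \<noteq> 0"
begin

abbreviation "P \<equiv> rho_Q1 s r g"
abbreviation "N x \<equiv> deriv (deriv g) x / deriv g x"
abbreviation "a \<equiv> dz_log s"
abbreviation "b \<equiv> dz_log r"
abbreviation "R x \<equiv> complex_of_real (r x)"
abbreviation "D \<equiv> inv_D s r g"

lemma U: "open U" using r by (rule density_open)

lemma R0: "x \<in> U \<Longrightarrow> R x \<noteq> 0" using density_pos[OF r] by force

lemma D1_nonzero: "x \<in> U \<Longrightarrow> D 1 x \<noteq> 0"
  using density_pos[OF r, of x] density_pos[OF s, OF gV, of x] g0[of x] by simp

lemma derivs:
  assumes "x \<in> U"
  shows "(g has_field_derivative deriv g x) (at x)"
    and "(deriv g has_field_derivative deriv (deriv g) x) (at x)"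
    and "((\<lambda>t. N t) has_field_derivative deriv (\<lambda>t. N t) x) (at x)"
    and "(schwarzian g has_field_derivative deriv (schwarzian g) x) (at x)"
proof -
  have 1: "deriv g holomorphic_on U" using g U by (rule holomorphic_deriv)
  have 2: "deriv (deriv g) holomorphic_on U" using 1 U by (rule holomorphic_deriv)
  have 3: "(\<lambda>t. N t) holomorphic_on U" using g0 by (intro holomorphic_intros 1 2) auto
  have 4: "schwarzian g holomorphic_on U"
    unfolding schwarzian_def[abs_def]
    using holomorphic_deriv[OF 3 U] 3 by (auto intro!: holomorphic_intros)
  show "(g has_field_derivative deriv g x) (at x)"
    "(deriv g has_field_derivative deriv (deriv g) x) (at x)"
    "((\<lambda>t. N t) has_field_derivative deriv (\<lambda>t. N t) x) (at x)"
    "(schwarzian g has_field_derivative deriv (schwarzian g) x) (at x)"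
    using g 1 2 3 4 U assms by (blast intro: holomorphic_derivI)+
qed

lemma has_dz_P:
  assumes "x \<in> U"
  shows "has_dz P (dz P x) x"
    and "dz P x = deriv (\<lambda>t. N t) x + 2 * (dz a (g x) * (deriv g x)\<^sup>2 + a (g x) * deriv (deriv g) x)
           - 2 * dz b x"
proof -
  have *: "has_dz P (deriv (\<lambda>t. N t) x + ((0 * a (g x) + 2 * (dz a (g x) * deriv g x)) * deriv g x
      + (2 * a (g x)) * deriv (deriv g) x) - (0 * b x + 2 * dz b x)) x"
    unfolding rho_Q1_def[abs_def] using assms
    by (intro has_dz_diff has_dz_add has_dz_mult has_dz_const has_dz_comp_holo[of a "dz a (g x)" g x "deriv g x"]
        has_dz_holo derivs has_dz_dz_log[OF r] has_dz_dz_log[OF s] gV)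
  then show "has_dz P (dz P x) x" by (simp add: has_dz_def)
  show "dz P x = deriv (\<lambda>t. N t) x + 2 * (dz a (g x) * (deriv g x)\<^sup>2 + a (g x) * deriv (deriv g) x)
           - 2 * dz b x"
    using has_dz_imp_dz[OF *] by (simp add: power2_eq_square algebra_simps)
qed

abbreviation "pull2 x \<equiv> log_density_schwarzian s (g x) * (deriv g x)\<^sup>2"

abbreviation "E x \<equiv> schwarzian g x + pull2 x - log_density_schwarzian r x"

text \<open>Completing the square turns \<open>- P^2/2 - 2 b P\<close> into
  \<open>2 b^2 - M^2/2\<close> with \<open>M = P + 2 b = N + 2 a(g) g'\<close>. The cross term
  \<open>2 N a(g) g'\<close> of \<open>M^2/2\<close> equals \<open>2 a(g) g''\<close> and cancels
  against the same term in \<open>dz P\<close>.\<close>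

lemma E_eq: "x \<in> U \<Longrightarrow> E x = dz P x - (P x)\<^sup>2 / 2 - 2 * b x * P x"
  using g0[of x] unfolding has_dz_P schwarzian_def log_density_schwarzian_def rho_Q1_def
  by (simp add: field_simps power2_eq_square)

text \<open>Pulling back does not commute with the operators \<open>Lam_coeff\<close>.
  Differentiating \<open>(g')^2\<close> contributes the factor \<open>2 N\<close>, and the two
  metric corrections contribute \<open>4 a(g) g'\<close> and \<open>- 4 b\<close>; their sum is
  \<open>2 P\<close>.\<close>

lemma has_dz_pull2:
  assumes "x \<in> U"
  shows "has_dz (\<lambda>x. pull2 x) (dz (\<lambda>x. pull2 x) x) x"
    and "Lam_coeff r 2 (\<lambda>x. pull2 x) x =
      Lam_coeff s 2 (log_density_schwarzian s) (g x) * (deriv g x) ^ 3 + 2 * P x * pull2 x"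
proof -
  have *: "has_dz (\<lambda>x. pull2 x) (dz (log_density_schwarzian s) (g x) * deriv g x * (deriv g x)\<^sup>2
      + log_density_schwarzian s (g x) * (2 * deriv g x * deriv (deriv g) x)) x"
    using assms
    by (intro has_dz_mult has_dz_power2 has_dz_holo derivs
        has_dz_comp_holo[of _ _ g x "deriv g x"] has_dz_log_density_schwarzian[OF s] gV)
  then show "has_dz (\<lambda>x. pull2 x) (dz (\<lambda>x. pull2 x) x) x" by (simp add: has_dz_def)
  show "Lam_coeff r 2 (\<lambda>x. pull2 x) x =
      Lam_coeff s 2 (log_density_schwarzian s) (g x) * (deriv g x) ^ 3 + 2 * P x * pull2 x"
    unfolding Lam_coeff_def has_dz_imp_dz[OF *] rho_Q1_def using g0[OF assms]
    by (simp add: field_simps power2_eq_square power3_eq_cube)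
qed

text \<open>Linearity of \<open>Lam_coeff\<close> in the differential. The surplus
  \<open>2 P\<close> times \<open>pull2\<close> is the origin of the \<open>Q1\<close> term in the
  theorem.\<close>

lemma has_dz_E:
  assumes "x \<in> U"
  shows "has_dz (\<lambda>x. E x) (dz (\<lambda>x. E x) x) x"
    and "Lam_coeff r 2 (\<lambda>x. E x) x = Lam_coeff r 2 (schwarzian g) x
      + Lam_coeff s 2 (log_density_schwarzian s) (g x) * (deriv g x) ^ 3
      - Lam_coeff r 2 (log_density_schwarzian r) x + 2 * P x * pull2 x"
proof -
  have *: "has_dz (\<lambda>x. E x) (deriv (schwarzian g) x + dz (\<lambda>x. pull2 x) x
      - dz (log_density_schwarzian r) x) x"
    using assms by (intro has_dz_diff has_dz_add has_dz_holo derivs has_dz_pull2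
       has_dz_log_density_schwarzian[OF r])
  then show "has_dz (\<lambda>x. E x) (dz (\<lambda>x. E x) x) x" by (simp add: has_dz_def)
  show "Lam_coeff r 2 (\<lambda>x. E x) x = Lam_coeff r 2 (schwarzian g) x
      + Lam_coeff s 2 (log_density_schwarzian s) (g x) * (deriv g x) ^ 3
      - Lam_coeff r 2 (log_density_schwarzian r) x + 2 * P x * pull2 x"
    using has_dz_pull2(2)[OF assms] has_dz_imp_dz[OF has_dz_holo[OF derivs(4)[OF assms]]]
    by (simp add: Lam_coeff_def has_dz_imp_dz[OF *] algebra_simps)
qed

text \<open>\<open>E_eq\<close> is solved for \<open>dz P\<close>, since \<open>E\<close> is already
  known to be differentiable. This yields the second derivative in exactly the form in which
  \<open>Lam_coeff\<close> of \<open>E\<close> will be recognized.\<close>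

lemma has_dz_dz_P:
  assumes "x \<in> U"
  shows "has_dz (dz P) (dz (dz P) x) x"
    and "dz (dz P) x = dz (\<lambda>x. E x) x + P x * dz P x + 2 * dz b x * P x + 2 * b x * dz P x"
proof -
  \<comment> \<open>The function is \<open>dz P\<close> rewritten by \<open>E_eq\<close>; the zero
    summands in its derivative are those produced by the product rule with a constant
    factor.\<close>
  have *: "has_dz (\<lambda>x. E x + P x * (1/2 * P x + 2 * b x)) (dz (\<lambda>x. E x) x
      + (dz P x * (1/2 * P x + 2 * b x) + P x * ((0 * P x + 1/2 * dz P x) + (0 * b x + 2 * dz b x)))) x"
    using assms by (intro has_dz_add has_dz_mult has_dz_const has_dz_E has_dz_P has_dz_dz_log[OF r])
  have **: "has_dz (dz P) (dz (\<lambda>x. E x) x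
      + (dz P x * (1/2 * P x + 2 * b x) + P x * ((0 * P x + 1/2 * dz P x) + (0 * b x + 2 * dz b x)))) x"
    by (rule has_dz_cong_on[OF * U assms]) (simp only: E_eq, simp add: power2_eq_square algebra_simps)
  then show "has_dz (dz P) (dz (dz P) x) x" by (simp add: has_dz_def)
  show "dz (dz P) x = dz (\<lambda>x. E x) x + P x * dz P x + 2 * dz b x * P x + 2 * b x * dz P x"
    using has_dz_imp_dz[OF **] by (simp add: algebra_simps)
qed

text \<open>The logarithmic derivative of \<open>D 1\<close> is \<open>N + a(g) g' - b\<close>; it
  is expressed through \<open>P\<close> so that the term in \<open>a\<close> can cancel in the
  recursion.\<close>

lemma has_dz_D1:
  assumes "x \<in> U"
  shows "has_dz (D 1) (D 1 x * (P x - a (g x) * deriv g x + b x)) x"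
proof -
  have s0: "complex_of_real (s (g x)) \<noteq> 0" using density_pos[OF s gV[OF assms]] by simp
  have "has_dz (\<lambda>x. of_real (s (g x)) / R x * deriv g x)
     ((of_real (s (g x)) * a (g x) * deriv g x * R x - of_real (s (g x)) * (R x * b x)) / (R x)\<^sup>2 * deriv g x
      + of_real (s (g x)) / R x * deriv (deriv g) x) x"
    using assms
    by (intro has_dz_mult has_dz_divide has_dz_holo derivs has_dz_comp_holo[of _ _ g x "deriv g x"]
         has_dz_density[OF s] has_dz_density[OF r] gV R0)
  moreover have "(of_real (s (g x)) * a (g x) * deriv g x * R x - of_real (s (g x)) * (R x * b x)) / (R x)\<^sup>2 * deriv g x
      + of_real (s (g x)) / R x * deriv (deriv g) x = D 1 x * (P x - a (g x) * deriv g x + b x)"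
    using R0[OF assms] g0[OF assms] s0
    by (simp add: rho_Q1_def divide_simps) (simp add: power2_eq_square algebra_simps)
  ultimately show ?thesis by simp
qed

text \<open>With \<open>F\<close> in the role of \<open>Q^m\<close>, this is the recursion for the
  quotients by \<open>D 1\<close>. The term \<open>- a(g) g'\<close> from the derivative of
  \<open>D 1\<close> cancels the target metric term in \<open>inv_D\<close>, and its term
  \<open>b\<close> lowers the factor \<open>m + 1\<close> to \<open>m\<close>.\<close>

lemma D_step:
  assumes F: "\<And>x. x \<in> U \<Longrightarrow> D (Suc m) x = D 1 x * F x" and F': "has_dz F F' x" and x: "x \<in> U"
  shows "D (Suc (Suc m)) x = D 1 x * (F' / R x + (P x - of_nat m * b x) / R x * F x)"
proof -
  have "has_dz (D (Suc m)) (D 1 x * (P x - a (g x) * deriv g x + b x) * F x + D 1 x * F') x"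
    by (rule has_dz_cong_on[OF has_dz_mult[OF has_dz_D1[OF x] F'] U x]) (simp only: F)
  then have dz: "dz (D (Suc m)) x = D 1 x * (P x - a (g x) * deriv g x + b x) * F x + D 1 x * F'"
    by (rule has_dz_imp_dz)
  have s0: "complex_of_real (s (g x)) \<noteq> 0" using density_pos[OF s gV[OF x]] by simp
  show ?thesis
    unfolding inv_D.simps(3) dz_metric_def dz F[OF x] dz_log_def[symmetric]
    using R0[OF x] s0 by (simp add: field_simps)
qed

text \<open>Closed forms of the first three quotients. They involve \<open>g\<close> and the target
  density only through \<open>P\<close>, so independence of the target coordinate reduces to that of
  \<open>P\<close>.\<close>

definition "Q1 x = P x / R x"
definition "Q2 x = (dz P x - 2 * b x * P x + (P x)\<^sup>2) / (R x)\<^sup>2"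
definition "Q3 x = (dz (dz P) x - 2 * dz b x * P x - 2 * b x * dz P x + 2 * P x * dz P x
  + (P x - 4 * b x) * (dz P x - 2 * b x * P x + (P x)\<^sup>2)) / (R x) ^ 3"

lemma inv_D_quotient:
  assumes "x \<in> U"
  shows "D 2 x / D 1 x = Q1 x" "D 3 x / D 1 x = Q2 x" "D 4 x / D 1 x = Q3 x"
proof -
  note dR = has_dz_density[OF r]
  \<comment> \<open>The recursion starts at \<open>m = 0\<close> with the constant quotient
    \<open>1\<close>. Each formula is proved on all of \<open>U\<close> because the next step
    differentiates it.\<close>
  have 2: "D (Suc (Suc 0)) x = D 1 x * Q1 x" if "x \<in> U" for x
    using D_step[of 0 "\<lambda>_. 1" 0 x] has_dz_const that by (simp add: Q1_def)
  have Q1': "has_dz Q1 ((dz P x * R x - P x * (R x * b x)) / (R x)\<^sup>2) x" if "x \<in> U" for x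
    unfolding Q1_def[abs_def] using that by (intro has_dz_divide has_dz_P dR R0)
  have 3: "D (Suc (Suc (Suc 0))) x = D 1 x * Q2 x" if "x \<in> U" for x
    using R0[OF that]
    by (intro trans[OF D_step[OF 2 Q1'[OF that] that]] arg_cong[of _ _ "(*) (D 1 x)"])
      (assumption, simp add: Q1_def Q2_def divide_simps, simp add: power2_eq_square algebra_simps)
  have Q2': "has_dz Q2 (((dz (dz P) x - ((0 * b x + 2 * dz b x) * P x + 2 * b x * dz P x) + 2 * P x * dz P x) * (R x)\<^sup>2
     - (dz P x - 2 * b x * P x + (P x)\<^sup>2) * (2 * R x * (R x * b x))) / ((R x)\<^sup>2)\<^sup>2) x" if "x \<in> U" for x
    unfolding Q2_def[abs_def] using that R0[OF that]
    by (intro has_dz_divide has_dz_add has_dz_diff has_dz_mult has_dz_power2 has_dz_const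
         has_dz_P has_dz_dz_P has_dz_dz_log[OF r] dR) auto
  have 4: "D (Suc (Suc (Suc (Suc 0)))) x = D 1 x * Q3 x" if "x \<in> U" for x
    using R0[OF that]
    by (intro trans[OF D_step[OF 3 Q2'[OF that] that]] arg_cong[of _ _ "(*) (D 1 x)"])
      (assumption, simp add: Q2_def Q3_def divide_simps, simp add: eval_nat_numeral algebra_simps)
  show "D 2 x / D 1 x = Q1 x" "D 3 x / D 1 x = Q2 x" "D 4 x / D 1 x = Q3 x"
    using 2[OF assms] 3[OF assms] 4[OF assms] D1_nonzero[OF assms]
    by (simp_all add: numeral_eq_Suc del: inv_D.simps)
qed

text \<open>The coefficients \<open>1\<close>, \<open>- 4\<close>, \<open>3\<close> cancel the cubic
  terms in \<open>P\<close>, and what remains is \<open>Lam_coeff\<close> of \<open>E\<close>,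
  divided by the cube of the density. Inserting the decomposition from \<open>has_dz_E\<close> gives
  the formula.\<close>

lemma Sigma3_local:
  assumes "x \<in> U"
  shows "Q3 x - 4 * Q1 x * Q2 x + 3 * (Q1 x) ^ 3 =
    inverse ((R x) ^ 3) * (Lam_coeff r 2 (schwarzian g) x
      + Lam_coeff s 2 (log_density_schwarzian s) (g x) * (deriv g x) ^ 3
      - Lam_coeff r 2 (log_density_schwarzian r) x) + 2 * inverse ((R x)\<^sup>2) * pull2 x * Q1 x"
proof -
  have "Q3 x - 4 * Q1 x * Q2 x + 3 * (Q1 x) ^ 3 = inverse ((R x) ^ 3) *
     (dz (dz P) x - 2 * dz b x * P x - 6 * b x * dz P x - P x * dz P x + 2 * b x * (P x)\<^sup>2 + 8 * (b x)\<^sup>2 * P x)"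
    using R0[OF assms] by (simp add: Q1_def Q2_def Q3_def divide_simps)
      (simp add: power2_eq_square power3_eq_cube algebra_simps)
  \<comment> \<open>Here \<open>E\<close> is expanded by \<open>E_eq\<close>, and
    \<open>dz (dz P)\<close> is traded for the derivative of \<open>E\<close>.\<close>
  also have "\<dots> = inverse ((R x) ^ 3) * Lam_coeff r 2 (\<lambda>x. E x) x"
    by (simp add: has_dz_dz_P(2)[OF assms] Lam_coeff_def E_eq[OF assms] del: mult_cancel_left)
      (simp add: power2_eq_square algebra_simps)
  \<comment> \<open>One factor of the inverse cube of the density is absorbed by \<open>P\<close>,
    turning the surplus into \<open>Q1\<close> times the inverse square.\<close>
  finally show ?thesis
    unfolding has_dz_E(2)[OF assms]
    by (simp only: Q1_def divide_inverse) (simp add: power2_eq_square power3_eq_cube algebra_simps)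
qed

end

section \<open>The Schwarzian and changes of coordinates\<close>

lemma deriv_cong_on:
  assumes "open U" "x \<in> U" "\<And>t. t \<in> U \<Longrightarrow> f t = h t"
  shows "deriv f x = deriv h x"
  using assms by (intro deriv_cong_ev) (auto simp: eventually_nhds)

lemma schwarzian_cong_on:
  assumes "open U" "x \<in> U" "\<And>t. t \<in> U \<Longrightarrow> f t = h t"
  shows "schwarzian f x = schwarzian h x"
proof -
  have 1: "deriv f t = deriv h t" if "t \<in> U" for t
    by (rule deriv_cong_on[OF assms(1) that assms(3)])
  have 2: "deriv (deriv f) t = deriv (deriv h) t" if "t \<in> U" for t
    by (rule deriv_cong_on[OF assms(1) that 1])
  have "deriv (\<lambda>t. deriv (deriv f) t / deriv f t) x = deriv (\<lambda>t. deriv (deriv h) t / deriv h t) x"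
    by (rule deriv_cong_on[OF assms(1,2)]) (simp add: 1 2)
  then show ?thesis using assms(2) by (simp add: schwarzian_def 1 2)
qed

text \<open>The logarithmic derivative of \<open>deriv\<close> of a Moebius map is
  \<open>u = - 2 c / (c t + d)\<close>, which solves \<open>u' = u^2 / 2\<close>.\<close>

lemma schwarzian_moebius:
  assumes "a * d - b * c \<noteq> 0" "c * x + d \<noteq> 0"
  shows "schwarzian (moebius a b c d) x = 0"
proof -
  let ?k = "a * d - b * c"
  \<comment> \<open>Removing the pole leaves an open set, on which the derivative formulas may be
    differentiated again.\<close>
  define W where "W = {t. c * t + d \<noteq> 0}"
  have W: "open W" "x \<in> W"
    unfolding W_def using assms(2) by (auto intro!: open_Collect_neq continuous_intros)
  have 1: "deriv (moebius a b c d) t = ?k / (c * t + d)\<^sup>2" if "t \<in> W" for t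
    using that unfolding moebius_def W_def
    by (intro DERIV_imp_deriv) (auto intro!: derivative_eq_intros simp: field_simps power2_eq_square)
  have 2: "deriv (deriv (moebius a b c d)) t = - 2 * c * ?k / (c * t + d) ^ 3" if "t \<in> W" for t
  proof -
    have "deriv (deriv (moebius a b c d)) t = deriv (\<lambda>t. ?k / (c * t + d)\<^sup>2) t"
      by (rule deriv_cong_on[OF W(1) that 1])
    also have "\<dots> = - 2 * c * ?k / (c * t + d) ^ 3"
      using that unfolding W_def
      by (intro DERIV_imp_deriv)
        (auto intro!: derivative_eq_intros simp: divide_simps power2_eq_square power3_eq_cube)
    finally show ?thesis .
  qed
  have 3: "deriv (deriv (moebius a b c d)) t / deriv (moebius a b c d) t = - 2 * c / (c * t + d)"
    if "t \<in> W" for t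
    using that assms(1) unfolding 1[OF that] 2[OF that] W_def
    by (simp add: divide_simps) (simp add: power2_eq_square power3_eq_cube)
  have "deriv (\<lambda>t. deriv (deriv (moebius a b c d)) t / deriv (moebius a b c d) t) x
      = deriv (\<lambda>t. - 2 * c / (c * t + d)) x"
    by (rule deriv_cong_on[OF W 3])
  also have "\<dots> = 2 * c\<^sup>2 / (c * x + d)\<^sup>2"
    using assms(2) by (intro DERIV_imp_deriv) (auto intro!: derivative_eq_intros simp: divide_simps power2_eq_square)
  finally show ?thesis
    using assms(2) unfolding schwarzian_def 3[OF W(2)] by (simp add: power2_eq_square)
qed

text \<open>Components of an open plane set are open, so near each point \<open>g\<close> coincides
  with a single Moebius map.\<close>

lemma locally_moebius_on_schwarzian:
  assumes "locally_moebius_on g S" "open S"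
  shows "g holomorphic_on S" and "x \<in> S \<Longrightarrow> schwarzian g x = 0"
proof -
  have *: "\<exists>a b c d C. open C \<and> x \<in> C \<and> a * d - b * c \<noteq> 0 \<and>
      (\<forall>t\<in>C. c * t + d \<noteq> 0 \<and> g t = moebius a b c d t)" if "x \<in> S" for x
  proof -
    have "x \<in> \<Union> (components S)" using that by simp
    then obtain C where C: "C \<in> components S" "x \<in> C" by (rule UnionE)
    have "open C" by (rule open_components[OF assms(2) C(1)])
    moreover from C(1) assms(1) obtain a b c d where "a * d - b * c \<noteq> 0"
      "\<forall>t\<in>C. c * t + d \<noteq> 0 \<and> g t = moebius a b c d t"
      unfolding locally_moebius_on_def by blast
    ultimately show ?thesis using C(2) by blast
  qed
  have "g field_differentiable (at x)" if x: "x \<in> S" for x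
  proof -
    obtain a b c d C where C: "open C" "x \<in> C"
      "\<forall>t\<in>C. c * t + d \<noteq> 0 \<and> g t = moebius a b c d t" using *[OF x] by blast
    have "(\<lambda>t. (a * t + b) / (c * t + d)) holomorphic_on C"
      using C(3) by (auto intro!: holomorphic_intros)
    then have "g holomorphic_on C"
      by (rule holomorphic_transform) (use C(3) in \<open>auto simp: moebius_def\<close>)
    then show ?thesis by (rule holomorphic_on_imp_differentiable_at) (use C(1,2) in auto)
  qed
  then show "g holomorphic_on S"
    by (auto simp: holomorphic_on_def intro: field_differentiable_at_within)
  show "schwarzian g x = 0" if x: "x \<in> S"
  proof -
    obtain a b c d C where C: "open C" "x \<in> C" "a * d - b * c \<noteq> 0"
      "\<forall>t\<in>C. c * t + d \<noteq> 0 \<and> g t = moebius a b c d t" using *[OF x] by blast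
    have "schwarzian g x = schwarzian (moebius a b c d) x"
      by (rule schwarzian_cong_on[OF C(1,2)]) (use C(4) in auto)
    then show ?thesis using schwarzian_moebius[OF C(3)] C(2,4) by simp
  qed
qed

text \<open>Writing \<open>N\<close> for second over first derivative, everything follows from the
  affine chain rule for \<open>N\<close>. In the Schwarzian, the term with \<open>N\<close> of
  \<open>h\<close> times \<open>g''\<close> cancels against the cross term of the square.\<close>

lemma
  assumes g: "g holomorphic_on U" "open U" "\<And>t. t \<in> U \<Longrightarrow> deriv g t \<noteq> 0"
    and h: "h holomorphic_on V" "open V" "\<And>t. t \<in> V \<Longrightarrow> deriv h t \<noteq> 0"
    and gV: "\<And>t. t \<in> U \<Longrightarrow> g t \<in> V" and x: "x \<in> U"
  shows deriv_comp: "deriv (\<lambda>t. h (g t)) x = deriv h (g x) * deriv g x"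
    and deriv_log_deriv_comp: "deriv (deriv (\<lambda>t. h (g t))) x / deriv (\<lambda>t. h (g t)) x =
      deriv (deriv h) (g x) / deriv h (g x) * deriv g x + deriv (deriv g) x / deriv g x"
    and schwarzian_comp: "schwarzian (\<lambda>t. h (g t)) x =
      schwarzian h (g x) * (deriv g x)\<^sup>2 + schwarzian g x"
proof -
  note g1 = holomorphic_deriv[OF g(1,2)]
  note h1 = holomorphic_deriv[OF h(1,2)]
  note g2 = holomorphic_deriv[OF g1 g(2)]
  note h2 = holomorphic_deriv[OF h1 h(2)]
  let ?Ng = "\<lambda>t. deriv (deriv g) t / deriv g t" and ?Nh = "\<lambda>t. deriv (deriv h) t / deriv h t"
  have Ng: "?Ng holomorphic_on U" using g g1 g2 by (auto intro!: holomorphic_intros)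
  have Nh: "?Nh holomorphic_on V" using h h1 h2 by (auto intro!: holomorphic_intros)
  have Dc: "((\<lambda>t. k (g t)) has_field_derivative deriv k (g t) * deriv g t) (at t)"
    if "k holomorphic_on V" "t \<in> U" for k t
    using holomorphic_derivI[OF that(1) h(2) gV[OF that(2)]] holomorphic_derivI[OF g(1,2) that(2)]
    by (rule DERIV_chain2)
  note D = holomorphic_derivI[OF _ g(2)] Dc
  have 1: "deriv (\<lambda>t. h (g t)) t = deriv h (g t) * deriv g t" if "t \<in> U" for t
    using that by (intro DERIV_imp_deriv D h(1) g(1))
  have 2: "deriv (deriv (\<lambda>t. h (g t))) t =
      deriv (deriv h) (g t) * (deriv g t)\<^sup>2 + deriv h (g t) * deriv (deriv g) t" if "t \<in> U" for t
  proof -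
    have "deriv (deriv (\<lambda>t. h (g t))) t = deriv (\<lambda>t. deriv h (g t) * deriv g t) t"
      by (rule deriv_cong_on[OF g(2) that 1])
    also have "\<dots> = deriv (deriv h) (g t) * deriv g t * deriv g t + deriv (deriv g) t * deriv h (g t)"
      using that by (intro DERIV_imp_deriv DERIV_mult D h1 g1 g(1))
    finally show ?thesis by (simp add: power2_eq_square)
  qed
  have 3: "deriv (deriv (\<lambda>t. h (g t))) t / deriv (\<lambda>t. h (g t)) t = ?Nh (g t) * deriv g t + ?Ng t"
    if "t \<in> U" for t
    unfolding 1[OF that] 2[OF that] using g(3)[OF that] h(3)[OF gV[OF that]]
    by (simp add: divide_simps) (simp add: power2_eq_square algebra_simps)
  have "deriv (\<lambda>t. deriv (deriv (\<lambda>t. h (g t))) t / deriv (\<lambda>t. h (g t)) t) x =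
      deriv (\<lambda>t. ?Nh (g t) * deriv g t + ?Ng t) x"
    by (rule deriv_cong_on[OF g(2) x 3])
  also have "\<dots> = deriv ?Nh (g x) * deriv g x * deriv g x + deriv (deriv g) x * ?Nh (g x) + deriv ?Ng x"
    using x by (intro DERIV_imp_deriv DERIV_add DERIV_mult D Nh Ng g1 g(1))
  finally have 4: "deriv (\<lambda>t. deriv (deriv (\<lambda>t. h (g t))) t / deriv (\<lambda>t. h (g t)) t) x =
    deriv ?Nh (g x) * deriv g x * deriv g x + deriv (deriv g) x * ?Nh (g x) + deriv ?Ng x" .
  show "deriv (\<lambda>t. h (g t)) x = deriv h (g x) * deriv g x" by (rule 1[OF x])
  show "deriv (deriv (\<lambda>t. h (g t))) x / deriv (\<lambda>t. h (g t)) x =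
      deriv (deriv h) (g x) / deriv h (g x) * deriv g x + deriv (deriv g) x / deriv g x"
    by (rule 3[OF x])
  show "schwarzian (\<lambda>t. h (g t)) x = schwarzian h (g x) * (deriv g x)\<^sup>2 + schwarzian g x"
    unfolding schwarzian_def 3[OF x] 4 using g(3)[OF x] h(3)[OF gV[OF x]]
    by (simp add: field_simps power2_eq_square)
qed

text \<open>The logarithmic derivatives of the intermediate density \<open>s\<close> cancel, which
  leaves the chain rule for second over first derivatives.\<close>

lemma rho_Q1_comp:
  assumes g: "g holomorphic_on U" "open U" "\<And>t. t \<in> U \<Longrightarrow> deriv g t \<noteq> 0"
    and h: "h holomorphic_on V" "open V" "\<And>t. t \<in> V \<Longrightarrow> deriv h t \<noteq> 0"
    and gV: "\<And>t. t \<in> U \<Longrightarrow> g t \<in> V" and x: "x \<in> U"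
  shows "rho_Q1 s' r (\<lambda>t. h (g t)) x = rho_Q1 s' s h (g x) * deriv g x + rho_Q1 s r g x"
proof -
  have 1: "deriv (\<lambda>t. h (g t)) x = deriv h (g x) * deriv g x"
    by (rule deriv_comp[OF assms])
  have 2: "deriv (deriv (\<lambda>t. h (g t))) x / deriv (\<lambda>t. h (g t)) x =
      deriv (deriv h) (g x) / deriv h (g x) * deriv g x + deriv (deriv g) x / deriv g x"
    by (rule deriv_log_deriv_comp[OF assms])
  show ?thesis unfolding rho_Q1_def 2 unfolding 1 by (simp add: algebra_simps)
qed

section \<open>Local isometries between densities\<close>

context
  fixes r s :: "complex \<Rightarrow> real" and T :: "complex \<Rightarrow> complex" and U V :: "complex set"
  assumes T: "conformal_immersion U V r s T"
    and isometry: "\<And>x. x \<in> U \<Longrightarrow> r x = s (T x) * cmod (deriv T x)"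
begin

interpretation conformal_immersion U V r s T by (rule T)

text \<open>Taking the logarithmic derivative of the isometry relation gives
  \<open>b = a(T) T' + T''/(2 T')\<close>, half of the factor \<open>2\<close> in
  \<open>rho_Q1\<close> being used up by the modulus.\<close>

lemma isometry_rho_Q1:
  assumes "x \<in> U"
  shows "rho_Q1 s r T x = 0"
proof -
  have s0: "complex_of_real (s (T x)) \<noteq> 0" using density_pos[OF s gV[OF assms]] by simp
  have *: "has_dz (\<lambda>x. of_real (s (T x)) * of_real (cmod (deriv T x)))
      (of_real (s (T x)) * a (T x) * deriv T x * of_real (cmod (deriv T x)) +
       of_real (s (T x)) * (of_real (cmod (deriv T x)) * deriv (deriv T) x / (2 * deriv T x))) x"
    using assms by (intro has_dz_mult has_dz_comp_holo[of _ _ T x "deriv T x"] has_dz_of_real_cmod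
        has_dz_density[OF s] gV g0 derivs)
  have "has_dz (\<lambda>x. R x)
      (of_real (s (T x)) * a (T x) * deriv T x * of_real (cmod (deriv T x)) +
       of_real (s (T x)) * (of_real (cmod (deriv T x)) * deriv (deriv T) x / (2 * deriv T x))) x"
    by (rule has_dz_cong_on[OF * U assms]) (simp add: isometry)
  from has_dz_imp_dz[OF this] has_dz_imp_dz[OF has_dz_density[OF r assms]]
  have "R x * b x = of_real (s (T x)) * of_real (cmod (deriv T x)) *
      (a (T x) * deriv T x + deriv (deriv T) x / (2 * deriv T x))"
    by (simp add: algebra_simps)
  then have "b x = a (T x) * deriv T x + deriv (deriv T) x / (2 * deriv T x)"
    using s0 g0[OF assms] by (simp add: isometry[OF assms])
  then show ?thesis by (simp add: rho_Q1_def)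
qed

text \<open>For an isometry \<open>P = 0\<close>, so \<open>E = 0\<close>: up to the Schwarzian of \<open>T\<close>, the Schwarzian of the
  metric is a quadratic differential.\<close>

lemma isometry_log_density_schwarzian:
  assumes S: "\<And>x. x \<in> U \<Longrightarrow> schwarzian T x = 0" and x: "x \<in> U"
  shows "log_density_schwarzian s (T x) * (deriv T x)\<^sup>2 = log_density_schwarzian r x"
    and "Lam_coeff s 2 (log_density_schwarzian s) (T x) * (deriv T x) ^ 3 =
      Lam_coeff r 2 (log_density_schwarzian r) x"
proof -
  have 0: "log_density_schwarzian s (T x) * (deriv T x)\<^sup>2 = log_density_schwarzian r x" if "x \<in> U" for x
  proof -
    have "dz P x = dz (\<lambda>_. 0) x" by (rule dz_cong_on[OF U that]) (rule isometry_rho_Q1)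
    then show ?thesis
      using E_eq[OF that] S[OF that] isometry_rho_Q1[OF that] has_dz_imp_dz[OF has_dz_const[of 0 x]] by simp
  qed
  show "log_density_schwarzian s (T x) * (deriv T x)\<^sup>2 = log_density_schwarzian r x"
    by (rule 0[OF x])
  \<comment> \<open>The first identity holds on the whole open set and can be differentiated; the
    surplus term of \<open>has_dz_pull2\<close> then drops since \<open>P = 0\<close>.\<close>
  have "dz (\<lambda>x. pull2 x) x = dz (log_density_schwarzian r) x"
    by (rule dz_cong_on[OF U x 0])
  then show "Lam_coeff s 2 (log_density_schwarzian s) (T x) * (deriv T x) ^ 3 =
      Lam_coeff r 2 (log_density_schwarzian r) x"
    using has_dz_pull2(2)[OF x] isometry_rho_Q1[OF x] 0[OF x] by (simp add: Lam_coeff_def)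
qed

end

section \<open>Charts and transition maps\<close>

lemma complex_chart_dom: "complex_chart X z \<Longrightarrow> chart_dom z \<subseteq> topspace X"
  by (simp add: complex_chart_def openin_subset)

lemma
  assumes "complex_chart X z"
  shows inj_on_chart: "inj_on (snd z) (chart_dom z)"
    and openin_chart_image: "openin X W \<Longrightarrow> open (snd z ` (chart_dom z \<inter> W))"
proof -
  have hm: "homeomorphic_map (subtopology X (chart_dom z)) (top_of_set (chart_img z)) (snd z)"
    and op: "open (chart_img z)" and dom: "openin X (chart_dom z)"
    using assms by (auto simp: complex_chart_def)
  have "topspace (subtopology X (chart_dom z)) = chart_dom z"
    using complex_chart_dom[OF assms] by auto
  then show "inj_on (snd z) (chart_dom z)"
    using homeomorphic_imp_injective_map[OF hm] by simp
  show "open (snd z ` (chart_dom z \<inter> W))" if "openin X W"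
  proof -
    have "openin (subtopology X (chart_dom z)) (chart_dom z \<inter> W)"
      using that by (rule openin_subtopology_Int2)
    then have "openin (top_of_set (chart_img z)) (snd z ` (chart_dom z \<inter> W))"
      using homeomorphic_imp_open_map[OF hm] by (simp add: open_map_def)
    then show ?thesis using op openin_open_eq by blast
  qed
qed

lemma chart_inv_in: "t \<in> chart_img z \<Longrightarrow> chart_inv z t \<in> chart_dom z"
  and chart_chart_inv: "t \<in> chart_img z \<Longrightarrow> snd z (chart_inv z t) = t"
  by (auto simp: chart_img_def chart_inv_def chart_dom_def inv_into_into f_inv_into_f)

lemma chart_inv_chart: "complex_chart X z \<Longrightarrow> p \<in> chart_dom z \<Longrightarrow> chart_inv z (snd z p) = p"
  using inj_on_chart[of X z] by (simp add: chart_inv_def chart_dom_def)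

lemma chart_in_img: "p \<in> chart_dom z \<Longrightarrow> snd z p \<in> chart_img z"
  by (auto simp: chart_img_def chart_dom_def)

lemma transition_chart:
  "complex_chart X z \<Longrightarrow> p \<in> chart_dom z \<Longrightarrow> transition z w (snd z p) = snd w p"
  by (simp add: transition_def chart_inv_chart)

lemma open_transition_dom:
  "complex_chart X z \<Longrightarrow> complex_chart X w \<Longrightarrow> open (transition_dom z w)"
  unfolding transition_dom_def by (rule openin_chart_image[of X]) (simp_all add: complex_chart_def)

lemma projective_atlasD:
  assumes "projective_atlas X A"
  shows "z \<in> A \<Longrightarrow> complex_chart X z" and "topspace X = (\<Union>z\<in>A. chart_dom z)"
    and "z \<in> A \<Longrightarrow> w \<in> A \<Longrightarrow> locally_moebius_on (transition z w) (transition_dom z w)"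
  using assms by (simp_all add: projective_atlas_def)

lemma complex_atlasD:
  "complex_atlas X A \<Longrightarrow> z \<in> A \<Longrightarrow> w \<in> A \<Longrightarrow> transition z w holomorphic_on transition_dom z w"
  by (simp add: complex_atlas_def)

lemma projective_atlas_imp_complex_atlas: "projective_atlas X A \<Longrightarrow> complex_atlas X A"
  unfolding projective_atlas_def complex_atlas_def
  by (meson locally_moebius_on_schwarzian(1) open_transition_dom)

lemma projective_coordinate_imp_local: "projective_coordinate X A z \<Longrightarrow> local_coordinate X A z"
  by (simp add: projective_coordinate_def local_coordinate_def projective_atlas_imp_complex_atlas)

lemma local_coordinate_chart: "local_coordinate X A z \<Longrightarrow> complex_chart X z"
  by (simp add: local_coordinate_def complex_atlas_def)

lemma transition_factor:
  assumes "complex_chart X w" "complex_chart X b" "complex_chart X w'"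
    and p: "p \<in> chart_dom w" "p \<in> chart_dom b" "p \<in> chart_dom w'"
  obtains W where "open W" "snd w p \<in> W" "W \<subseteq> transition_dom w b" "W \<subseteq> transition_dom w w'"
    "\<And>t. t \<in> W \<Longrightarrow> transition w b t \<in> transition_dom b w'"
    "\<And>t. t \<in> W \<Longrightarrow> transition b w' (transition w b t) = transition w w' t"
proof
  let ?W = "snd w ` (chart_dom w \<inter> (chart_dom b \<inter> chart_dom w'))"
  show "open ?W" using assms(1-3) by (intro openin_chart_image) (auto simp: complex_chart_def)
  show "snd w p \<in> ?W" using p by blast
  show "?W \<subseteq> transition_dom w b" "?W \<subseteq> transition_dom w w'" by (auto simp: transition_dom_def)
  fix t assume "t \<in> ?W"
  then obtain q where q: "q \<in> chart_dom w" "q \<in> chart_dom b" "q \<in> chart_dom w'" "t = snd w q"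
    by blast
  show "transition w b t \<in> transition_dom b w'"
    using q by (simp add: transition_chart[OF assms(1)] transition_dom_def)
  show "transition b w' (transition w b t) = transition w w' t"
    using q by (simp add: transition_chart[OF assms(1)] transition_chart[OF assms(2)])
qed


section \<open>Transitions between two arbitrary coordinates\<close>

context
  fixes X :: "'a topology" and A w w'
  assumes A: "projective_atlas X A"
    and w: "local_coordinate X A w" and w': "local_coordinate X A w'"
begin

text \<open>Each of \<open>w\<close> and \<open>w'\<close> is assumed compatible with the atlas
  \<open>A\<close>, but not directly with the other. Locally their transition is therefore routed
  through a chart \<open>b\<close> of \<open>A\<close>.\<close>

lemma transition_factor_atlas:
  assumes "t \<in> transition_dom w w'"
  obtains b W where "b \<in> A" "open W" "t \<in> W" "W \<subseteq> transition_dom w b" "W \<subseteq> transition_dom w w'"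
    "\<And>t. t \<in> W \<Longrightarrow> transition w b t \<in> transition_dom b w'"
    "\<And>t. t \<in> W \<Longrightarrow> transition b w' (transition w b t) = transition w w' t"
proof -
  obtain p where p: "p \<in> chart_dom w" "p \<in> chart_dom w'" "t = snd w p"
    using assms by (auto simp: transition_dom_def)
  note c = local_coordinate_chart[OF w] local_coordinate_chart[OF w']
  have "p \<in> topspace X" using p complex_chart_dom[OF c(1)] by blast
  then obtain b where b: "b \<in> A" "p \<in> chart_dom b"
    using projective_atlasD(2)[OF A] by auto
  note cb = projective_atlasD(1)[OF A b(1)]
  show ?thesis
    by (rule transition_factor[OF c(1) cb c(2) p(1) b(2) p(2)]) (use that b p(3) in blast)
qed

lemma local_transition_atlas:
  assumes "b \<in> A"
  shows "transition w b holomorphic_on transition_dom w b"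
    and "transition b w' holomorphic_on transition_dom b w'"
  using complex_atlasD[OF w[unfolded local_coordinate_def]]
    complex_atlasD[OF w'[unfolded local_coordinate_def]] assms by simp_all

lemma holomorphic_transition: "transition w w' holomorphic_on transition_dom w w'"
proof -
  have "transition w w' field_differentiable (at t)" if t: "t \<in> transition_dom w w'" for t
  proof -
    obtain b W where b: "b \<in> A" and W: "open W" "t \<in> W" "W \<subseteq> transition_dom w b"
      "W \<subseteq> transition_dom w w'"
      "\<And>t. t \<in> W \<Longrightarrow> transition w b t \<in> transition_dom b w'"
      "\<And>t. t \<in> W \<Longrightarrow> transition b w' (transition w b t) = transition w w' t"
      by (rule transition_factor_atlas[OF t]) blast
    have "(transition b w' \<circ> transition w b) holomorphic_on W"
      using local_transition_atlas[OF b] W(3,5)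
      by (intro holomorphic_on_compose_gen) (auto intro: holomorphic_on_subset)
    then have "transition w w' holomorphic_on W"
      by (rule holomorphic_transform) (simp add: W(6))
    then show ?thesis by (rule holomorphic_on_imp_differentiable_at) (use W(1,2) in auto)
  qed
  then show ?thesis by (auto simp: holomorphic_on_def intro: field_differentiable_at_within)
qed

lemma transition_maps_to: "t \<in> transition_dom w w' \<Longrightarrow> transition w w' t \<in> chart_img w'"
  by (auto simp: transition_dom_def transition_chart[OF local_coordinate_chart[OF w]] intro: chart_in_img)

text \<open>Charts are injective, hence so is the transition, and an injective holomorphic map has
  no critical points.\<close>

lemma deriv_transition_nonzero:
  assumes "t \<in> transition_dom w w'"
  shows "deriv (transition w w') t \<noteq> 0"
proof (rule holomorphic_injective_imp_regular[OF holomorphic_transition _ _ assms])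
  note c = local_coordinate_chart[OF w] local_coordinate_chart[OF w']
  show "open (transition_dom w w')" by (rule open_transition_dom[OF c])
  show "inj_on (transition w w') (transition_dom w w')"
  proof (rule inj_onI)
    fix x y assume xy: "x \<in> transition_dom w w'" "y \<in> transition_dom w w'"
      "transition w w' x = transition w w' y"
    obtain p q where pq: "p \<in> chart_dom w" "p \<in> chart_dom w'" "x = snd w p"
      "q \<in> chart_dom w" "q \<in> chart_dom w'" "y = snd w q"
      using xy(1,2) unfolding transition_dom_def by blast
    then have "snd w' p = snd w' q" using xy(3) by (simp add: transition_chart[OF c(1)])
    then have "p = q" by (rule inj_onD[OF inj_on_chart[OF c(2)]]) fact+
    then show "x = y" by (simp add: pq)
  qed
qed

end

text \<open>Both factors through a chart of \<open>A\<close> are locally Moebius and have Schwarzian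
  zero; the chain rule for the Schwarzian then settles their composition.\<close>

lemma schwarzian_transition:
  assumes A: "projective_atlas X A"
    and w: "projective_coordinate X A w" and w': "projective_coordinate X A w'"
    and t: "t \<in> transition_dom w w'"
  shows "schwarzian (transition w w') t = 0"
proof -
  note l = projective_coordinate_imp_local[OF w] projective_coordinate_imp_local[OF w']
  obtain b W where b: "b \<in> A" and W: "open W" "t \<in> W" "W \<subseteq> transition_dom w b"
    "W \<subseteq> transition_dom w w'"
    "\<And>t. t \<in> W \<Longrightarrow> transition w b t \<in> transition_dom b w'"
    "\<And>t. t \<in> W \<Longrightarrow> transition b w' (transition w b t) = transition w w' t"
    by (rule transition_factor_atlas[OF A l t]) blast
  have lb: "local_coordinate X A b"
    using A b by (simp add: local_coordinate_def projective_atlas_imp_complex_atlas insert_absorb)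
  note c = local_coordinate_chart[OF l(1)] local_coordinate_chart[OF lb] local_coordinate_chart[OF l(2)]
  have m: "locally_moebius_on (transition w b) (transition_dom w b)"
    "locally_moebius_on (transition b w') (transition_dom b w')"
    using projective_atlasD(3)[OF w[unfolded projective_coordinate_def]]
      projective_atlasD(3)[OF w'[unfolded projective_coordinate_def]] b by simp_all
  have "schwarzian (transition w w') t = schwarzian (\<lambda>t. transition b w' (transition w b t)) t"
    by (rule schwarzian_cong_on[OF W(1,2)]) (simp add: W(6))
  also have "\<dots> = schwarzian (transition b w') (transition w b t) * (deriv (transition w b) t)\<^sup>2
      + schwarzian (transition w b) t"
  proof (rule schwarzian_comp)
    show "transition w b holomorphic_on W"
      using holomorphic_transition[OF A l(1) lb] W(3) by (rule holomorphic_on_subset)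
    show "transition b w' holomorphic_on transition_dom b w'" by (rule holomorphic_transition[OF A lb l(2)])
    show "open (transition_dom b w')" by (rule open_transition_dom[OF c(2,3)])
    show "deriv (transition w b) t \<noteq> 0" if "t \<in> W" for t
      using deriv_transition_nonzero[OF A l(1) lb] W(3) that by blast
    show "deriv (transition b w') t \<noteq> 0" if "t \<in> transition_dom b w'" for t
      by (rule deriv_transition_nonzero[OF A lb l(2) that])
  qed (use W in auto)
  also have "\<dots> = 0"
    using locally_moebius_on_schwarzian(2)[OF m(1) open_transition_dom[OF c(1,2)]]
      locally_moebius_on_schwarzian(2)[OF m(2) open_transition_dom[OF c(2,3)]] W(2,3,5) by auto
  finally show ?thesis .
qed

lemma conformal_metricD:
  assumes "conformal_metric X A \<rho>" and z: "local_coordinate X A z"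
  shows "smooth_density (\<rho> z) (chart_img z)"
    and "local_coordinate X A w \<Longrightarrow> \<zeta> \<in> transition_dom z w \<Longrightarrow>
      \<rho> z \<zeta> = \<rho> w (transition z w \<zeta>) * cmod (deriv (transition z w) \<zeta>)"
proof -
  have "open (chart_img z)"
    using local_coordinate_chart[OF z] by (simp add: complex_chart_def)
  moreover have "smooth_on (\<rho> z) (chart_img z)" "\<forall>\<zeta>\<in>chart_img z. \<rho> z \<zeta> > 0"
    using assms unfolding conformal_metric_def by blast+
  ultimately show "smooth_density (\<rho> z) (chart_img z)" by (simp add: smooth_density_def)
  show "local_coordinate X A w \<Longrightarrow> \<zeta> \<in> transition_dom z w \<Longrightarrow>
      \<rho> z \<zeta> = \<rho> w (transition z w \<zeta>) * cmod (deriv (transition z w) \<zeta>)"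
    using assms unfolding conformal_metric_def by blast
qed

text \<open>Makes the results on isometries available for changes of coordinate, the transformation
  law of \<open>\<sigma>\<close> being the isometry relation.\<close>

lemma conformal_immersion_transition:
  assumes "projective_atlas X A" "local_coordinate X A w" "local_coordinate X A w'"
    and \<sigma>: "conformal_metric X A \<sigma>"
  shows "conformal_immersion (transition_dom w w') (chart_img w') (\<sigma> w) (\<sigma> w') (transition w w')"
proof
  note c = local_coordinate_chart[OF assms(2)] local_coordinate_chart[OF assms(3)]
  note sd = conformal_metricD(1)[OF \<sigma>]
  show "smooth_density (\<sigma> w') (chart_img w')" by (rule sd[OF assms(3)])
  have "transition_dom w w' \<subseteq> chart_img w"
    by (auto simp: transition_dom_def chart_img_def chart_dom_def)
  then show "smooth_density (\<sigma> w) (transition_dom w w')"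
    using smooth_density_subset[OF sd[OF assms(2)] open_transition_dom[OF c]] by blast
qed (use assms in \<open>auto intro: holomorphic_transition transition_maps_to dest: deriv_transition_nonzero\<close>)

section \<open>Independence of the target coordinate\<close>

lemma Theta_2: "Theta \<rho> 2 z = log_density_schwarzian (\<rho> z)"
  by (simp add: Theta_def log_density_schwarzian_def[abs_def])

lemma Theta_3: "Theta \<rho> 3 z = Lam_coeff (\<rho> z) 2 (log_density_schwarzian (\<rho> z))"
  by (simp add: Theta_def log_density_schwarzian_def[abs_def] Lam_def Lam_coeff_def[abs_def])

context
  fixes X :: "'a topology" and Y :: "'b topology" and A B \<rho> \<sigma> f z
  assumes A: "projective_atlas X A" and B: "projective_atlas Y B"
    and \<rho>: "conformal_metric X A \<rho>" and \<sigma>: "conformal_metric Y B \<sigma>"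
    and f: "holomorphic_surface_map X A Y B f"
    and z: "local_coordinate X A z"
begin

lemma domain_iff: "t \<in> snd z ` {p \<in> chart_dom z. f p \<in> chart_dom w} \<longleftrightarrow>
    t \<in> chart_img z \<and> f (chart_inv z t) \<in> chart_dom w" (is "?l \<longleftrightarrow> ?r")
proof
  assume ?l
  then obtain p where "p \<in> chart_dom z" "f p \<in> chart_dom w" "t = snd z p" by blast
  then show ?r by (simp add: chart_inv_chart[OF local_coordinate_chart[OF z]] chart_in_img)
next
  assume ?r
  then show ?l using chart_inv_in[of t z] chart_chart_inv[of t z]
    by (intro image_eqI[of _ _ "chart_inv z t"]) simp_all
qed

definition regular_set :: "'b chart \<Rightarrow> complex set" where
  "regular_set w = {t \<in> snd z ` {p \<in> chart_dom z. f p \<in> chart_dom w}. deriv (coord_rep z w f) t \<noteq> 0}"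

lemma regular_set_iff: "t \<in> regular_set w \<longleftrightarrow>
    t \<in> chart_img z \<and> f (chart_inv z t) \<in> chart_dom w \<and> deriv (coord_rep z w f) t \<noteq> 0"
  unfolding regular_set_def mem_Collect_eq domain_iff by blast

context
  fixes w assumes w: "local_coordinate Y B w"
begin

lemma open_domain: "open (snd z ` {p \<in> chart_dom z. f p \<in> chart_dom w})"
proof -
  have "openin X {p \<in> topspace X. f p \<in> chart_dom w}"
    using f local_coordinate_chart[OF w]
    by (auto simp: holomorphic_surface_map_def complex_chart_def intro: openin_continuous_map_preimage)
  moreover have "{p \<in> chart_dom z. f p \<in> chart_dom w} =
      chart_dom z \<inter> {p \<in> topspace X. f p \<in> chart_dom w}"
    using complex_chart_dom[OF local_coordinate_chart[OF z]] by blast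
  ultimately show ?thesis
    using openin_chart_image[OF local_coordinate_chart[OF z]] by simp
qed

lemma holomorphic_coord_rep:
  "coord_rep z w f holomorphic_on (snd z ` {p \<in> chart_dom z. f p \<in> chart_dom w})"
  using f z w unfolding holomorphic_surface_map_def by blast

text \<open>The locale demands an open domain; continuity of the holomorphic derivative provides
  it.\<close>

lemma conformal_immersion_coord_rep:
  "conformal_immersion (regular_set w) (chart_img w) (\<rho> z) (\<sigma> w) (coord_rep z w f)"
proof
  let ?S = "snd z ` {p \<in> chart_dom z. f p \<in> chart_dom w}"
  have eq: "regular_set w = ?S \<inter> deriv (coord_rep z w f) -` (- {0})"
    by (auto simp: regular_set_def)
  have "continuous_on ?S (deriv (coord_rep z w f))"
    by (intro holomorphic_on_imp_continuous_on holomorphic_deriv holomorphic_coord_rep open_domain)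
  then have op: "open (regular_set w)"
    unfolding eq by (rule continuous_open_preimage) (auto intro: open_domain)
  have "smooth_density (\<rho> z) (chart_img z)"
    by (rule conformal_metricD(1)[OF \<rho> z])
  then show "smooth_density (\<rho> z) (regular_set w)"
    by (rule smooth_density_subset[OF _ op]) (auto simp: regular_set_iff)
  show "smooth_density (\<sigma> w) (chart_img w)"
    by (rule conformal_metricD(1)[OF \<sigma> w])
  show "coord_rep z w f holomorphic_on regular_set w"
    by (rule holomorphic_on_subset[OF holomorphic_coord_rep]) (auto simp: regular_set_def)
qed (auto simp: regular_set_iff coord_rep_def intro: chart_in_img)

end

context
  fixes w w' t
  assumes w: "local_coordinate Y B w" and w': "local_coordinate Y B w'"
    and t: "t \<in> regular_set w" and w't: "f (chart_inv z t) \<in> chart_dom w'"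
begin

private abbreviation (input) "g \<equiv> coord_rep z w f"
private abbreviation (input) "T \<equiv> transition w w'"

interpretation g: conformal_immersion "regular_set w" "chart_img w" "\<rho> z" "\<sigma> w" g
  by (rule conformal_immersion_coord_rep[OF w])
interpretation T: conformal_immersion "transition_dom w w'" "chart_img w'" "\<sigma> w" "\<sigma> w'" T
  by (rule conformal_immersion_transition[OF B w w' \<sigma>])

text \<open>A whole neighbourhood of \<open>t\<close> is needed, because derivatives of the two
  coordinate representations are compared.\<close>

lemma overlap:
  obtains W where "open W" "t \<in> W" "W \<subseteq> regular_set w"
    "\<And>x. x \<in> W \<Longrightarrow> f (chart_inv z x) \<in> chart_dom w'"
    "\<And>x. x \<in> W \<Longrightarrow> g x \<in> transition_dom w w'"
    "\<And>x. x \<in> W \<Longrightarrow> coord_rep z w' f x = T (g x)"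
proof
  let ?S = "snd z ` {p \<in> chart_dom z. f p \<in> chart_dom w'}"
  let ?W = "regular_set w \<inter> ?S"
  show "open ?W" using g.U open_domain[OF w'] by blast
  note S = domain_iff[of _ w']
  show "t \<in> ?W" using t w't S[of t] by (auto simp: regular_set_iff)
  show "?W \<subseteq> regular_set w" by simp
  fix x assume "x \<in> ?W"
  then have x: "f (chart_inv z x) \<in> chart_dom w" "f (chart_inv z x) \<in> chart_dom w'"
    using S[of x] by (auto simp: regular_set_iff)
  show "f (chart_inv z x) \<in> chart_dom w'" by (rule x)
  show "g x \<in> transition_dom w w'"
    using x by (auto simp: coord_rep_def transition_dom_def)
  show "coord_rep z w' f x = T (g x)"
    using x by (simp add: coord_rep_def transition_chart[OF local_coordinate_chart[OF w]])
qed

text \<open>All three are chain rules for composition with the transition \<open>T\<close>; for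
  \<open>rho_Q1\<close> the contribution of \<open>T\<close> vanishes since \<open>T\<close> is an
  isometry.\<close>

lemma deriv_change: "deriv (coord_rep z w' f) t = deriv T (g t) * deriv g t"
  and rho_Q1_change: "rho_Q1 (\<sigma> w') (\<rho> z) (coord_rep z w' f) t = rho_Q1 (\<sigma> w) (\<rho> z) g t"
  and schwarzian_change: "schwarzian (coord_rep z w' f) t =
    schwarzian T (g t) * (deriv g t)\<^sup>2 + schwarzian g t"
proof -
  obtain W where W: "open W" "t \<in> W" "W \<subseteq> regular_set w"
    "\<And>x. x \<in> W \<Longrightarrow> f (chart_inv z x) \<in> chart_dom w'"
    "\<And>x. x \<in> W \<Longrightarrow> g x \<in> transition_dom w w'"
    "\<And>x. x \<in> W \<Longrightarrow> coord_rep z w' f x = T (g x)"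
    by (rule overlap) blast
  have gW: "g holomorphic_on W" using g.g W(3) by (rule holomorphic_on_subset)
  have g0: "deriv g x \<noteq> 0" if "x \<in> W" for x using that W(3) g.g0 by blast
  note comp = gW W(1) g0 T.g T.U T.g0 W(5) W(2)
  have d1: "deriv (\<lambda>x. T (g x)) x = deriv (coord_rep z w' f) x" if "x \<in> W" for x
    by (rule deriv_cong_on[OF W(1) that]) (simp add: W(6))
  have d2: "deriv (deriv (\<lambda>x. T (g x))) t = deriv (deriv (coord_rep z w' f)) t"
    by (rule deriv_cong_on[OF W(1,2) d1])
  show "deriv (coord_rep z w' f) t = deriv T (g t) * deriv g t"
    unfolding d1[OF W(2), symmetric] by (rule deriv_comp[OF comp])
  have "rho_Q1 (\<sigma> w') (\<rho> z) (\<lambda>x. T (g x)) t =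
      rho_Q1 (\<sigma> w') (\<sigma> w) T (g t) * deriv g t + rho_Q1 (\<sigma> w) (\<rho> z) g t"
    by (rule rho_Q1_comp[OF comp])
  moreover have "rho_Q1 (\<sigma> w') (\<sigma> w) T (g t) = 0"
    by (intro isometry_rho_Q1[OF T.conformal_immersion_axioms] W(5) W(2)
        conformal_metricD(2)[OF \<sigma> w w'])
  ultimately show "rho_Q1 (\<sigma> w') (\<rho> z) (coord_rep z w' f) t = rho_Q1 (\<sigma> w) (\<rho> z) g t"
    using d1[OF W(2)] d2 W(6)[OF W(2)] by (simp add: rho_Q1_def)
  have "schwarzian (coord_rep z w' f) t = schwarzian (\<lambda>x. T (g x)) t"
    by (rule schwarzian_cong_on[OF W(1,2)]) (simp add: W(6))
  also have "\<dots> = schwarzian T (g t) * (deriv g t)\<^sup>2 + schwarzian g t"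
    by (rule schwarzian_comp[OF comp])
  finally show "schwarzian (coord_rep z w' f) t =
    schwarzian T (g t) * (deriv g t)\<^sup>2 + schwarzian g t" .
qed

text \<open>Transitions have nonvanishing derivative, so being a critical point of \<open>f\<close>
  does not depend on the target coordinate.\<close>

lemma overlap_regular: "t \<in> regular_set w'"
proof -
  have "g t \<in> transition_dom w w'"
    using t w't by (auto simp: regular_set_iff coord_rep_def transition_dom_def)
  then show ?thesis
    using t w't deriv_change T.g0 by (auto simp: regular_set_iff)
qed

text \<open>Between projective coordinates the Schwarzian of \<open>T\<close> is zero. This removes
  the extra term in the chain rule and is also the hypothesis under which the Schwarzian of the
  metric transforms as a differential.\<close>

lemma pullback_change:
  assumes "projective_coordinate Y B w" "projective_coordinate Y B w'"
  shows "schwarzian (coord_rep z w' f) t = schwarzian g t"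
    and "Theta \<sigma> 2 w' (coord_rep z w' f t) * deriv (coord_rep z w' f) t ^ 2 =
      Theta \<sigma> 2 w (g t) * deriv g t ^ 2"
    and "Theta \<sigma> 3 w' (coord_rep z w' f t) * deriv (coord_rep z w' f) t ^ 3 =
      Theta \<sigma> 3 w (g t) * deriv g t ^ 3"
proof -
  have gt: "g t \<in> transition_dom w w'"
    using t w't by (auto simp: regular_set_iff coord_rep_def transition_dom_def)
  have eq: "coord_rep z w' f t = T (g t)"
    using t by (simp add: coord_rep_def transition_chart[OF local_coordinate_chart[OF w]] regular_set_iff)
  note S = schwarzian_transition[OF B assms]
  show "schwarzian (coord_rep z w' f) t = schwarzian g t"
    by (simp add: schwarzian_change S[OF gt])
  note iso = isometry_log_density_schwarzian[OF T.conformal_immersion_axioms conformal_metricD(2)[OF \<sigma> w w'] S gt]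
  show "Theta \<sigma> 2 w' (coord_rep z w' f t) * deriv (coord_rep z w' f) t ^ 2 =
      Theta \<sigma> 2 w (g t) * deriv g t ^ 2"
    unfolding Theta_2 eq deriv_change power_mult_distrib mult.assoc[symmetric] by (simp only: iso(1))
  show "Theta \<sigma> 3 w' (coord_rep z w' f t) * deriv (coord_rep z w' f) t ^ 3 =
      Theta \<sigma> 3 w (g t) * deriv g t ^ 3"
    unfolding Theta_3 eq deriv_change power_mult_distrib mult.assoc[symmetric] by (simp only: iso(2))
qed

end


text \<open>The closed forms depend on the target coordinate only through \<open>rho_Q1\<close> and
  its first two derivatives, and \<open>rho_Q1\<close> agrees for both coordinates near
  \<open>t\<close>.\<close>

lemma inv_D_quotient_change:
  assumes w: "local_coordinate Y B w" and w': "local_coordinate Y B w'"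
    and t: "t \<in> regular_set w" and w't: "f (chart_inv z t) \<in> chart_dom w'"
    and n: "n \<in> {1, 2, 3}"
  shows "inv_D (\<sigma> w') (\<rho> z) (coord_rep z w' f) (n + 1) t / inv_D (\<sigma> w') (\<rho> z) (coord_rep z w' f) 1 t =
    inv_D (\<sigma> w) (\<rho> z) (coord_rep z w f) (n + 1) t / inv_D (\<sigma> w) (\<rho> z) (coord_rep z w f) 1 t"
proof -
  interpret g: conformal_immersion "regular_set w" "chart_img w" "\<rho> z" "\<sigma> w" "coord_rep z w f"
    by (rule conformal_immersion_coord_rep[OF w])
  interpret g': conformal_immersion "regular_set w'" "chart_img w'" "\<rho> z" "\<sigma> w'" "coord_rep z w' f"
    by (rule conformal_immersion_coord_rep[OF w'])
  let ?P = "rho_Q1 (\<sigma> w) (\<rho> z) (coord_rep z w f)" and ?P' = "rho_Q1 (\<sigma> w') (\<rho> z) (coord_rep z w' f)"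
  obtain W where W: "open W" "t \<in> W" "W \<subseteq> regular_set w"
    "\<And>x. x \<in> W \<Longrightarrow> f (chart_inv z x) \<in> chart_dom w'"
    by (rule overlap[OF w w' t w't]) blast
  have 0: "?P' x = ?P x" if "x \<in> W" for x
    by (rule rho_Q1_change[OF w w' _ W(4)]) (use that W(3) in auto)
  have 1: "dz ?P' x = dz ?P x" if "x \<in> W" for x by (rule dz_cong_on[OF W(1) that 0])
  have 2: "dz (dz ?P') t = dz (dz ?P) t" by (rule dz_cong_on[OF W(1,2) 1])
  have t': "t \<in> regular_set w'" by (rule overlap_regular[OF w w' t w't])
  show ?thesis
    using n g.inv_D_quotient[OF t] g'.inv_D_quotient[OF t']
    by (elim insertE) (simp_all only: g.Q1_def g'.Q1_def g.Q2_def g'.Q2_def g.Q3_def g'.Q3_def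
      0[OF W(2)] 1[OF W(2)] 2 numeral_plus_one one_plus_numeral one_add_one semiring_norm empty_iff)
qed

text \<open>Agreement of all coordinates gives existence of the described value, and the admissible
  coordinate \<open>w\<close> gives uniqueness.\<close>

lemma the_coordinate_value:
  assumes "C w" "D w" "\<And>w'. C w' \<Longrightarrow> D w' \<Longrightarrow> F w' = F w"
  shows "(THE s. \<forall>w'. C w' \<longrightarrow> D w' \<longrightarrow> s = F w') = F w"
proof (rule the_equality)
  show "\<forall>w'. C w' \<longrightarrow> D w' \<longrightarrow> F w = F w'" using assms(3) by simp
  show "s = F w" if "\<forall>w'. C w' \<longrightarrow> D w' \<longrightarrow> s = F w'" for s using that assms(1,2) by simp
qed

lemma inv_Q_eq:
  assumes w: "local_coordinate Y B w" and t: "t \<in> regular_set w" and n: "n \<in> {1, 2, 3}"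
  shows "inv_Q Y B \<sigma> \<rho> n f z t =
    inv_D (\<sigma> w) (\<rho> z) (coord_rep z w f) (n + 1) t / inv_D (\<sigma> w) (\<rho> z) (coord_rep z w f) 1 t"
  unfolding inv_Q_def
proof (rule the_coordinate_value[where F = "\<lambda>w. inv_D (\<sigma> w) (\<rho> z) (coord_rep z w f) (n + 1) t /
      inv_D (\<sigma> w) (\<rho> z) (coord_rep z w f) 1 t" and w = w])
  show "local_coordinate Y B w" "f (chart_inv z t) \<in> chart_dom w"
    using w t by (simp_all add: regular_set_iff)
  fix w' assume "local_coordinate Y B w'" "f (chart_inv z t) \<in> chart_dom w'"
  from inv_D_quotient_change[OF w this(1) t this(2) n]
  show "inv_D (\<sigma> w') (\<rho> z) (coord_rep z w' f) (n + 1) t / inv_D (\<sigma> w') (\<rho> z) (coord_rep z w' f) 1 t =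
    inv_D (\<sigma> w) (\<rho> z) (coord_rep z w f) (n + 1) t / inv_D (\<sigma> w) (\<rho> z) (coord_rep z w f) 1 t" .
qed

section \<open>Evaluation of the invariant quantities in one projective target coordinate\<close>

context
  fixes w t
  assumes w: "projective_coordinate Y B w" and t: "t \<in> regular_set w"
begin

lemma proj_schwarzian_eq: "proj_schwarzian Y B f z t = schwarzian (coord_rep z w f) t"
  unfolding proj_schwarzian_def
proof (rule the_coordinate_value[where F = "\<lambda>w. schwarzian (coord_rep z w f) t" and w = w])
  show "projective_coordinate Y B w" by (rule w)
  show "f (chart_inv z t) \<in> chart_dom w" using t by (simp add: regular_set_iff)
  show "schwarzian (coord_rep z w' f) t = schwarzian (coord_rep z w f) t"
    if "projective_coordinate Y B w'" "f (chart_inv z t) \<in> chart_dom w'" for w'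
    by (intro pullback_change projective_coordinate_imp_local w t that)
qed

lemma pullback_Theta_eq:
  "pullback Y B f 2 (Theta \<sigma> 2) z t =
     log_density_schwarzian (\<sigma> w) (coord_rep z w f t) * deriv (coord_rep z w f) t ^ 2"
  "pullback Y B f 3 (Theta \<sigma> 3) z t =
     Lam_coeff (\<sigma> w) 2 (log_density_schwarzian (\<sigma> w)) (coord_rep z w f t) * deriv (coord_rep z w f) t ^ 3"
proof -
  have dom: "f (chart_inv z t) \<in> chart_dom w" using t by (simp add: regular_set_iff)
  have *: "pullback Y B f n (Theta \<sigma> n) z t = Theta \<sigma> n w (coord_rep z w f t) * deriv (coord_rep z w f) t ^ n"
    if "n \<in> {2, 3}" for n
    unfolding pullback_def
  proof (rule the_coordinate_value[where F = "\<lambda>w. Theta \<sigma> n w (coord_rep z w f t) * deriv (coord_rep z w f) t ^ n" and w = w])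
    show "projective_coordinate Y B w" "f (chart_inv z t) \<in> chart_dom w" by (rule w dom)+
    fix w' assume w': "projective_coordinate Y B w'" "f (chart_inv z t) \<in> chart_dom w'"
    note change = pullback_change[OF projective_coordinate_imp_local[OF w]
      projective_coordinate_imp_local[OF w'(1)] t w'(2) w w'(1)]
    show "Theta \<sigma> n w' (coord_rep z w' f t) * deriv (coord_rep z w' f) t ^ n =
      Theta \<sigma> n w (coord_rep z w f t) * deriv (coord_rep z w f) t ^ n"
      using that change(2,3) by blast
  qed
  show "pullback Y B f 2 (Theta \<sigma> 2) z t =
     log_density_schwarzian (\<sigma> w) (coord_rep z w f t) * deriv (coord_rep z w f) t ^ 2"
    "pullback Y B f 3 (Theta \<sigma> 3) z t =
     Lam_coeff (\<sigma> w) 2 (log_density_schwarzian (\<sigma> w)) (coord_rep z w f t) * deriv (coord_rep z w f) t ^ 3"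
    using *[of 2] *[of 3] by (simp_all only: Theta_2 Theta_3 insert_iff simp_thms)
qed

end

text \<open>\<open>V3\<close> differentiates \<open>proj_schwarzian\<close>, so the evaluation in
  \<open>w\<close> is used on the whole open regular set and not only at \<open>t\<close>.\<close>

lemma V3_eq:
  assumes w: "projective_coordinate Y B w" and t: "t \<in> regular_set w"
  shows "V3 \<rho> Y B f z t = Lam_coeff (\<rho> z) 2 (schwarzian (coord_rep z w f)) t"
proof -
  interpret g: conformal_immersion "regular_set w" "chart_img w" "\<rho> z" "\<sigma> w" "coord_rep z w f"
    by (rule conformal_immersion_coord_rep[OF projective_coordinate_imp_local[OF w]])
  have "dz (proj_schwarzian Y B f z) t = dz (schwarzian (coord_rep z w f)) t"
    by (rule dz_cong_on[OF g.U t proj_schwarzian_eq[OF w]])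
  then show ?thesis by (simp add: V3_def Lam_def Lam_coeff_def proj_schwarzian_eq[OF w t])
qed

text \<open>A projective coordinate is also a local one, so the same \<open>w\<close> evaluates the
  descriptions in \<open>inv_Q\<close>, \<open>V3\<close> and \<open>pullback\<close>
  simultaneously, and the plane identity applies.\<close>

lemma Sigma3_formula:
  assumes w: "projective_coordinate Y B w" and t: "t \<in> regular_set w"
  shows "Sigma3 Y B \<sigma> \<rho> f z t =
    inverse (complex_of_real (\<rho> z t) ^ 3) *
      (V3 \<rho> Y B f z t + pullback Y B f 3 (Theta \<sigma> 3) z t - Theta \<rho> 3 z t)
    + 2 * inverse (complex_of_real (\<rho> z t) ^ 2) *
      pullback Y B f 2 (Theta \<sigma> 2) z t * inv_Q Y B \<sigma> \<rho> 1 f z t"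
proof -
  note l = projective_coordinate_imp_local[OF w]
  interpret g: conformal_immersion "regular_set w" "chart_img w" "\<rho> z" "\<sigma> w" "coord_rep z w f"
    by (rule conformal_immersion_coord_rep[OF l])
  have Q: "inv_Q Y B \<sigma> \<rho> 1 f z t = g.Q1 t" "inv_Q Y B \<sigma> \<rho> 2 f z t = g.Q2 t"
    "inv_Q Y B \<sigma> \<rho> 3 f z t = g.Q3 t"
    using inv_Q_eq[OF l t, of 1] inv_Q_eq[OF l t, of 2] inv_Q_eq[OF l t, of 3] g.inv_D_quotient[OF t]
    by (simp_all del: inv_D.simps add: numeral_eq_Suc)
  show ?thesis
    unfolding Sigma3_def Q V3_eq[OF w t] pullback_Theta_eq[OF w t] Theta_3
    by (rule g.Sigma3_local[OF t])
qed

end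

theorem theorem5p3:
  fixes X :: "'a topology" and Y :: "'b topology"
    and A :: "'a chart set" and B :: "'b chart set"
    and \<rho> :: "'a chart \<Rightarrow> complex \<Rightarrow> real" and \<sigma> :: "'b chart \<Rightarrow> complex \<Rightarrow> real"
    and f :: "'a \<Rightarrow> 'b" and z :: "'a chart" and w :: "'b chart" and \<zeta> :: complex
  assumes "projective_surface X A" and "projective_surface Y B"
    and "conformal_metric X A \<rho>" and "conformal_metric Y B \<sigma>"
    and "holomorphic_surface_map X A Y B f" and "\<not> f constant_on topspace X"
    and "projective_coordinate X A z" and "\<zeta> \<in> chart_img z"
    and "local_coordinate Y B w" and "f (chart_inv z \<zeta>) \<in> chart_dom w"
    and "deriv (coord_rep z w f) \<zeta> \<noteq> 0"
  shows "Sigma3 Y B \<sigma> \<rho> f z \<zeta> =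
    inverse (complex_of_real (\<rho> z \<zeta>) ^ 3) *
      (V3 \<rho> Y B f z \<zeta> + pullback Y B f 3 (Theta \<sigma> 3) z \<zeta> - Theta \<rho> 3 z \<zeta>)
    + 2 * inverse (complex_of_real (\<rho> z \<zeta>) ^ 2) *
      pullback Y B f 2 (Theta \<sigma> 2) z \<zeta> * inv_Q Y B \<sigma> \<rho> 1 f z \<zeta>"
proof -
  have A: "projective_atlas X A" and B: "projective_atlas Y B"
    using assms(1,2) by (auto simp: projective_surface_def)
  note l = projective_coordinate_imp_local[OF assms(7)]
  note ctx = A B assms(3-5) l
  \<comment> \<open>The given \<open>w\<close> is only a local coordinate, whereas \<open>V3\<close>
    and the pull-backs refer to projective ones; a chart \<open>b\<close> of \<open>B\<close> around
    the image point takes its place.\<close>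
  have "f (chart_inv z \<zeta>) \<in> topspace Y"
    using assms(10) complex_chart_dom[OF local_coordinate_chart[OF assms(9)]] by blast
  then obtain b where b: "b \<in> B" "f (chart_inv z \<zeta>) \<in> chart_dom b"
    using projective_atlasD(2)[OF B] by auto
  have pb: "projective_coordinate Y B b"
    using B b(1) by (simp add: projective_coordinate_def insert_absorb)
  have "\<zeta> \<in> regular_set f z w"
    using assms(8,10,11) by (simp add: regular_set_iff[OF ctx])
  \<comment> \<open>Nonvanishing of the derivative carries over from \<open>w\<close> to
    \<open>b\<close>.\<close>
  then have "\<zeta> \<in> regular_set f z b"
    by (rule overlap_regular[OF ctx assms(9) projective_coordinate_imp_local[OF pb] _ b(2)])
  then show ?thesis by (rule Sigma3_formula[OF ctx pb])
qed

end
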